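(* Let $\{T_n\}_{n\ge1}$ be any family of trees such that $T_n$ has $n$ vertices, and let $T_\lambda=T_{\lambda_1}\cup\dots\cup T_{\lambda_{\ell(\lambda)}}$ (disjoint union) for a partition $\lambda$; then $\{X_{T_\lambda}\}_\lambda$ is a basis of $\Lambda$. For every weighted graph $(G,\omega)$ and every $k\in\mathbb{N}$, \[\sum_{\lambda:\ \ell(\lambda)=k}[X_{T_\lambda}]X_{(G,\omega)}=\sum_{\lambda:\ \ell(\lambda)=k}[X_{P_\lambda}]X_{(G,\omega)}.\] In particular the polynomial obtained from $X_{(G,\omega)}$ by expanding in the basis $\{X_{T_\lambda}\}$ and replacing each $X_{T_\lambda}$ by $x^{\ell(\lambda)}$ is independent of the choice of the family $\{T_n\}$ and equals $\tau_{(G,\omega)}$.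
   Context: A weighted graph $(G,\omega)$ is a finite simple graph with $\omega:V(G)\to\{1,2,\dots\}$, and $X_{(G,\omega)}=\sum_\kappa\prod_{v\in V(G)}x_{\kappa(v)}^{\omega(v)}$, summed over proper colourings $\kappa:V(G)\to\{1,2,\dots\}$; unweighted graphs correspond to $\omega\equiv1$. $P_n$ is the path on $n$ vertices and $P_\lambda$ the disjoint union of $P_{\lambda_i}$; $\{X_{P_\lambda}\}$ is a basis of the algebra $\Lambda$ of symmetric functions over $\mathbb{Q}$. $[b]f$ denotes the coefficient of basis element $b$ in $f$. For $f=\sum_\lambda a_\lambda X_{P_\lambda}$, $\tau_f(x)=\sum_\lambda a_\lambda x^{\ell(\lambda)}$ and $\tau_{(G,\omega)}=\tau_{X_{(G,\omega)}}$. *)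

theory Defs
  imports Main "HOL-Library.FuncSet" "HOL-Computational_Algebra.Polynomial"
begin

definition simple_graph :: "'v set \<Rightarrow> ('v \<Rightarrow> 'v \<Rightarrow> bool) \<Rightarrow> bool" where
  "simple_graph V E \<longleftrightarrow> finite V \<and> (\<forall>x y. E x y \<longrightarrow> x \<in> V \<and> y \<in> V)
     \<and> (\<forall>x y. E x y \<longrightarrow> E y x) \<and> (\<forall>x. \<not> E x x)"

definition weighted_graph :: "'v set \<Rightarrow> ('v \<Rightarrow> 'v \<Rightarrow> bool) \<Rightarrow> ('v \<Rightarrow> nat) \<Rightarrow> bool" where
  "weighted_graph V E \<omega> \<longleftrightarrow> simple_graph V E \<and> (\<forall>v\<in>V. \<omega> v \<ge> 1)"

definition connected_graph :: "'v set \<Rightarrow> ('v \<Rightarrow> 'v \<Rightarrow> bool) \<Rightarrow> bool" where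
  "connected_graph V E \<longleftrightarrow> (\<forall>u\<in>V. \<forall>v\<in>V. (\<lambda>x y. E x y \<and> x \<in> V \<and> y \<in> V)\<^sup>*\<^sup>* u v)"

definition is_cycle :: "'v set \<Rightarrow> ('v \<Rightarrow> 'v \<Rightarrow> bool) \<Rightarrow> 'v list \<Rightarrow> bool" where
  "is_cycle V E xs \<longleftrightarrow> length xs \<ge> 3 \<and> distinct xs \<and> set xs \<subseteq> V
     \<and> (\<forall>i. Suc i < length xs \<longrightarrow> E (xs ! i) (xs ! Suc i)) \<and> E (last xs) (hd xs)"

definition tree :: "'v set \<Rightarrow> ('v \<Rightarrow> 'v \<Rightarrow> bool) \<Rightarrow> bool" where
  "tree V E \<longleftrightarrow> simple_graph V E \<and> V \<noteq> {} \<and> connected_graph V E \<and> (\<nexists>xs. is_cycle V E xs)"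

definition partitions :: "nat list set" where
  "partitions = {lam. sorted_wrt (\<ge>) lam \<and> 0 \<notin> set lam}"

definition union_V :: "(nat \<Rightarrow> 'b set) \<Rightarrow> nat list \<Rightarrow> (nat \<times> 'b) set" where
  "union_V TV lam = {(i, v). i < length lam \<and> v \<in> TV (lam ! i)}"

definition union_E :: "(nat \<Rightarrow> 'b \<Rightarrow> 'b \<Rightarrow> bool) \<Rightarrow> nat list \<Rightarrow> (nat \<times> 'b) \<Rightarrow> (nat \<times> 'b) \<Rightarrow> bool" where
  "union_E TE lam p q = (fst p = fst q \<and> fst p < length lam \<and> TE (lam ! fst p) (snd p) (snd q))"

definition path_V :: "nat \<Rightarrow> nat set" where
  "path_V n = {0..<n}"

definition path_E :: "nat \<Rightarrow> nat \<Rightarrow> nat \<Rightarrow> bool" where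
  "path_E n i j = (i < n \<and> j < n \<and> (Suc i = j \<or> Suc j = i))"

text \<open>A formal series with rational coefficients is a function from monomials (exponent vectors
  \<open>nat \<Rightarrow> nat\<close>, only finitely supported ones being relevant) to rat.\<close>
type_synonym series = "(nat \<Rightarrow> nat) \<Rightarrow> rat"

definition chrom :: "'v set \<Rightarrow> ('v \<Rightarrow> 'v \<Rightarrow> bool) \<Rightarrow> ('v \<Rightarrow> nat) \<Rightarrow> series" where
  "chrom V E \<omega> \<alpha> = of_nat (card {\<kappa> \<in> extensional V.
      (\<forall>u\<in>V. \<forall>v\<in>V. E u v \<longrightarrow> \<kappa> u \<noteq> \<kappa> v)
      \<and> (\<forall>i. (\<Sum>v\<in>{v\<in>V. \<kappa> v = i}. \<omega> v) = \<alpha> i)})"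

definition Sym :: "series set" where
  "Sym = {f. (\<forall>\<alpha>. infinite {i. \<alpha> i \<noteq> 0} \<longrightarrow> f \<alpha> = 0)
           \<and> (\<forall>\<sigma> \<alpha>. bij \<sigma> \<longrightarrow> f (\<alpha> \<circ> \<sigma>) = f \<alpha>)
           \<and> (\<exists>N. \<forall>\<alpha>. sum \<alpha> {i. \<alpha> i \<noteq> 0} > N \<longrightarrow> f \<alpha> = 0)}"

definition coeff_family :: "(nat list \<Rightarrow> rat) \<Rightarrow> bool" where
  "coeff_family a \<longleftrightarrow> finite {lam. a lam \<noteq> 0} \<and> {lam. a lam \<noteq> 0} \<subseteq> partitions"

definition lincomb :: "(nat list \<Rightarrow> rat) \<Rightarrow> (nat list \<Rightarrow> series) \<Rightarrow> series" where
  "lincomb a B = (\<lambda>\<alpha>. \<Sum>lam\<in>{lam. a lam \<noteq> 0}. a lam * B lam \<alpha>)"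

definition is_basis :: "(nat list \<Rightarrow> series) \<Rightarrow> bool" where
  "is_basis B \<longleftrightarrow> (\<forall>lam\<in>partitions. B lam \<in> Sym)
     \<and> (\<forall>f\<in>Sym. \<exists>!a. coeff_family a \<and> f = lincomb a B)"

definition bcoeff :: "(nat list \<Rightarrow> series) \<Rightarrow> series \<Rightarrow> nat list \<Rightarrow> rat" where
  "bcoeff B f = (THE a. coeff_family a \<and> f = lincomb a B)"

definition tau :: "(nat list \<Rightarrow> series) \<Rightarrow> series \<Rightarrow> rat poly" where
  "tau B f = (\<Sum>lam\<in>{lam. bcoeff B f lam \<noteq> 0}. monom (bcoeff B f lam) (length lam))"

definition XP :: "nat list \<Rightarrow> series" where
  "XP lam = chrom (union_V path_V lam) (union_E path_E lam) (\<lambda>_. 1)"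

end

theory Submission
  imports Defs "HOL-Library.Multiset" "HOL-Library.Countable_Set"
begin

text \<open>
  Inclusion-exclusion over the edges of a forest with \<open>n\<close> vertices expands its chromatic symmetric
  function as a signed sum of power sums \<open>p\<^bsub>\<lambda>(S)\<^esub>\<close> over edge sets \<open>S\<close>, with
  \<open>\<ell>(\<lambda>(S)) = n - |S|\<close>. For \<open>T\<^sub>\<lambda>\<close> the shortest term is \<open>\<plusminus> p\<^sub>\<lambda>\<close>, so the
  change from power sums to \<open>X\<^bsub>T\<^esub>\<close> is triangular by length; the change from monomial symmetric
  functions to power sums is triangular by length in the opposite direction, and both are invertible.

  For \<open>m \<ge> 2\<close>, setting \<open>m\<close> variables equal to \<open>1/(m-1)\<close> and the others to \<open>0\<close> turns the
  chromatic symmetric function of a forest with \<open>n\<close> vertices and \<open>k\<close> components into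
  \<open>m\<^sup>k (m-1)\<^bsup>n-k\<^esup> / (m-1)\<^sup>n = (m/(m-1))\<^sup>k\<close>. Hence the polynomial obtained from \<open>f\<close> by expanding
  in any of these bases and replacing \<open>X\<close> of \<open>T\<^sub>\<lambda>\<close> by \<open>x\<^bsup>\<ell>(\<lambda>)\<^esup>\<close> takes at
  \<open>x = m/(m-1)\<close> the value of this specialisation of \<open>f\<close>, and these infinitely many values
  determine it.
\<close>

section \<open>Colourings with prescribed content\<close>

text \<open>All colourings that contribute to the monomial \<open>\<alpha>\<close>, proper or not:
  inclusion-exclusion will impose equalities of colours on this set instead of inequalities.\<close>

definition contents :: "'v set \<Rightarrow> ('v \<Rightarrow> nat) \<Rightarrow> (nat \<Rightarrow> nat) \<Rightarrow> ('v \<Rightarrow> nat) set" where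
  "contents V w \<alpha> = {\<kappa> \<in> extensional V. \<forall>i. (\<Sum>v\<in>{v\<in>V. \<kappa> v = i}. w v) = \<alpha> i}"

lemma chrom_contents:
  "chrom V E w \<alpha> = of_nat (card {\<kappa> \<in> contents V w \<alpha>. \<forall>u\<in>V. \<forall>v\<in>V. E u v \<longrightarrow> \<kappa> u \<noteq> \<kappa> v})"
  unfolding chrom_def contents_def by (rule arg_cong[where f = "\<lambda>A. of_nat (card A)"]) auto

text \<open>With positive weights a colour class has weight zero only when it is empty, so the
  exponent vector records exactly which colours occur.\<close>

lemma contents_image:
  assumes "finite V" "\<forall>v\<in>V. w v \<ge> 1" "\<kappa> \<in> contents V w \<alpha>"
  shows "\<kappa> ` V = {i. \<alpha> i \<noteq> 0}"
proof -
  have "\<alpha> i \<noteq> 0 \<longleftrightarrow> i \<in> \<kappa> ` V" for i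
  proof -
    have "\<alpha> i = (\<Sum>v\<in>{v\<in>V. \<kappa> v = i}. w v)"
      using assms(3) by (simp add: contents_def)
    then have "\<alpha> i = 0 \<longleftrightarrow> (\<forall>v\<in>{v\<in>V. \<kappa> v = i}. w v = 0)"
      using assms(1) by simp
    then show ?thesis
      using assms(2) by fastforce
  qed
  then show ?thesis by auto
qed

lemma contents_sum:
  assumes "finite V" "\<forall>v\<in>V. w v \<ge> 1" "\<kappa> \<in> contents V w \<alpha>"
  shows "sum \<alpha> {i. \<alpha> i \<noteq> 0} = sum w V"
proof -
  have "sum w V = (\<Sum>i\<in>\<kappa> ` V. \<Sum>v\<in>{v\<in>V. \<kappa> v = i}. w v)"
    by (rule sum.image_gen) fact
  also have "\<dots> = sum \<alpha> (\<kappa> ` V)"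
    using assms(3) by (simp add: contents_def)
  finally show ?thesis
    using contents_image[OF assms] by simp
qed

text \<open>The exponent vector confines the colours to a finite set. This matters for the counts,
  since \<open>card\<close> of an infinite set is 0.\<close>

lemma finite_contents:
  assumes "finite V" "\<forall>v\<in>V. w v \<ge> 1"
  shows "finite (contents V w \<alpha>)"
proof (cases "contents V w \<alpha> = {}")
  case False
  then obtain \<kappa> where "\<kappa> \<in> contents V w \<alpha>" by blast
  then have "finite {i. \<alpha> i \<noteq> 0}"
    using contents_image[OF assms] assms(1) by (metis finite_imageI)
  then have "finite (V \<rightarrow>\<^sub>E {i. \<alpha> i \<noteq> 0})"
    using assms(1) by (intro finite_PiE)
  moreover have "contents V w \<alpha> \<subseteq> V \<rightarrow>\<^sub>E {i. \<alpha> i \<noteq> 0}"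
  proof
    fix \<kappa> assume k: "\<kappa> \<in> contents V w \<alpha>"
    then have "\<kappa> \<in> extensional V" by (simp add: contents_def)
    then show "\<kappa> \<in> V \<rightarrow>\<^sub>E {i. \<alpha> i \<noteq> 0}"
      using contents_image[OF assms k] by (auto simp: PiE_iff)
  qed
  ultimately show ?thesis by (rule finite_subset[rotated])
qed simp

lemma chrom_nonzeroD:
  assumes "finite V" "\<forall>v\<in>V. w v \<ge> 1" "chrom V E w \<alpha> \<noteq> 0"
  shows "finite {i. \<alpha> i \<noteq> 0}" "sum \<alpha> {i. \<alpha> i \<noteq> 0} = sum w V"
proof -
  from assms(3) have "contents V w \<alpha> \<noteq> {}"
    by (auto simp: chrom_contents)
  then obtain \<kappa> where k: "\<kappa> \<in> contents V w \<alpha>" by blast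
  show "finite {i. \<alpha> i \<noteq> 0}"
    using contents_image[OF assms(1,2) k] assms(1) by (metis finite_imageI)
  show "sum \<alpha> {i. \<alpha> i \<noteq> 0} = sum w V"
    using contents_sum[OF assms(1,2) k] .
qed

lemma chrom_permute:
  assumes "bij \<sigma>"
  shows "chrom V E w (\<alpha> \<circ> \<sigma>) = chrom V E w \<alpha>"
proof -
  let ?K = "\<lambda>\<alpha>. {\<kappa> \<in> contents V w \<alpha>. \<forall>u\<in>V. \<forall>v\<in>V. E u v \<longrightarrow> \<kappa> u \<noteq> \<kappa> v}"
  have inj: "inj \<sigma>" using assms by (rule bij_is_inj)
  \<comment> \<open>Under \<open>\<sigma> \<circ> \<kappa>\<close> the class of colour
    \<open>i\<close> is the class of \<open>inv \<sigma> i\<close> under \<kappa>, whose weight is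
    \<open>\<alpha> (\<sigma> (inv \<sigma> i)) = \<alpha> i\<close>.\<close>
  have "bij_betw (\<lambda>\<kappa>. restrict (\<sigma> \<circ> \<kappa>) V) (?K (\<alpha> \<circ> \<sigma>)) (?K \<alpha>)"
  proof (rule bij_betw_byWitness[where f' = "\<lambda>\<kappa>. restrict (inv \<sigma> \<circ> \<kappa>) V"])
    have s: "\<sigma> (inv \<sigma> i) = i" and s': "inv \<sigma> (\<sigma> i) = i" for i
      using assms by (simp_all add: bij_is_surj surj_f_inv_f bij_is_inj)
    have *: "{v\<in>V. restrict (\<sigma> \<circ> \<kappa>) V v = i} = {v\<in>V. \<kappa> v = inv \<sigma> i}" for \<kappa> i
      using s[of i] s' by auto
    have **: "{v\<in>V. restrict (inv \<sigma> \<circ> \<kappa>) V v = i} = {v\<in>V. \<kappa> v = \<sigma> i}" for \<kappa> i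
      using s'[of i] s by auto
    show "\<forall>\<kappa>\<in>?K (\<alpha> \<circ> \<sigma>). restrict (inv \<sigma> \<circ> restrict (\<sigma> \<circ> \<kappa>) V) V = \<kappa>"
      using s' by (auto simp: contents_def extensional_def restrict_def fun_eq_iff)
    show "\<forall>\<kappa>\<in>?K \<alpha>. restrict (\<sigma> \<circ> restrict (inv \<sigma> \<circ> \<kappa>) V) V = \<kappa>"
      using s by (auto simp: contents_def extensional_def restrict_def fun_eq_iff)
    show "(\<lambda>\<kappa>. restrict (\<sigma> \<circ> \<kappa>) V) ` ?K (\<alpha> \<circ> \<sigma>) \<subseteq> ?K \<alpha>"
    proof (rule image_subsetI)
      fix \<kappa> assume k: "\<kappa> \<in> ?K (\<alpha> \<circ> \<sigma>)"
      then have "\<forall>u\<in>V. \<forall>v\<in>V. E u v \<longrightarrow> \<sigma> (\<kappa> u) \<noteq> \<sigma> (\<kappa> v)"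
        using s' by (metis (mono_tags, lifting) mem_Collect_eq)
      with k show "restrict (\<sigma> \<circ> \<kappa>) V \<in> ?K \<alpha>"
        by (simp add: contents_def * s del: restrict_apply) simp
    qed
    show "(\<lambda>\<kappa>. restrict (inv \<sigma> \<circ> \<kappa>) V) ` ?K \<alpha> \<subseteq> ?K (\<alpha> \<circ> \<sigma>)"
    proof (rule image_subsetI)
      fix \<kappa> assume k: "\<kappa> \<in> ?K \<alpha>"
      then have "\<forall>u\<in>V. \<forall>v\<in>V. E u v \<longrightarrow> inv \<sigma> (\<kappa> u) \<noteq> inv \<sigma> (\<kappa> v)"
        using s by (metis (mono_tags, lifting) mem_Collect_eq)
      with k show "restrict (inv \<sigma> \<circ> \<kappa>) V \<in> ?K (\<alpha> \<circ> \<sigma>)"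
        by (simp add: contents_def ** del: restrict_apply) simp
    qed
  qed
  then show ?thesis
    unfolding chrom_contents by (simp add: bij_betw_same_card)
qed

lemma chrom_in_Sym:
  assumes "weighted_graph V E w"
  shows "chrom V E w \<in> Sym"
proof -
  have fin: "finite V" and w: "\<forall>v\<in>V. w v \<ge> 1"
    using assms by (auto simp: weighted_graph_def simple_graph_def)
  have "\<forall>\<alpha>. sum \<alpha> {i. \<alpha> i \<noteq> 0} > sum w V \<longrightarrow> chrom V E w \<alpha> = 0"
    using chrom_nonzeroD(2)[OF fin w] by (metis less_irrefl)
  moreover have "infinite {i. \<alpha> i \<noteq> 0} \<longrightarrow> chrom V E w \<alpha> = 0" for \<alpha>
    using chrom_nonzeroD(1)[OF fin w] by blast
  ultimately show ?thesis
    unfolding Sym_def using chrom_permute by fast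
qed

section \<open>Edgeless graphs and power sums\<close>

abbreviation discrete :: "'v set \<Rightarrow> ('v \<Rightarrow> nat) \<Rightarrow> series" where
  "discrete V w \<equiv> chrom V (\<lambda>_ _. False) w"

lemma discrete_contents: "discrete V w \<alpha> = of_nat (card (contents V w \<alpha>))"
  by (simp add: chrom_contents)

lemma contents_cong:
  assumes "\<And>v. v \<in> V \<Longrightarrow> w v = w' v"
  shows "contents V w \<alpha> = contents V w' \<alpha>"
proof -
  have "(\<Sum>v\<in>{v\<in>V. \<kappa> v = i}. w v) = (\<Sum>v\<in>{v\<in>V. \<kappa> v = i}. w' v)" for \<kappa> :: "_ \<Rightarrow> nat" and i
    by (rule sum.cong) (simp_all add: assms)
  then show ?thesis by (simp add: contents_def)
qed

text \<open>Contraction of the fibres of \<open>q\<close>: composition with \<open>q\<close> pairs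
  the two sets, and giving each fibre its total weight preserves the content. It serves both to
  contract forest edges and to relabel vertices.\<close>

lemma card_contents_factoring:
  assumes "finite V"
  shows "card {\<kappa> \<in> contents V w \<alpha>. \<exists>\<kappa>'. \<forall>v\<in>V. \<kappa> v = \<kappa>' (q v)}
    = card (contents (q ` V) (\<lambda>r. \<Sum>v\<in>{v\<in>V. q v = r}. w v) \<alpha>)"
proof -
  let ?w = "\<lambda>r. \<Sum>v\<in>{v\<in>V. q v = r}. w v"
  have group: "(\<Sum>v\<in>{v\<in>V. \<kappa>' (q v) = i}. w v) = (\<Sum>r\<in>{r\<in>q ` V. \<kappa>' r = i}. ?w r)"
    for \<kappa>' :: "_ \<Rightarrow> nat" and i
  proof -
    have "(\<Sum>v\<in>{v\<in>V. \<kappa>' (q v) = i}. w v)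
      = (\<Sum>r\<in>{r\<in>q ` V. \<kappa>' r = i}. \<Sum>v\<in>{v. v\<in>{v\<in>V. \<kappa>' (q v) = i} \<and> q v = r}. w v)"
      by (rule sum.group[symmetric]) (use assms in auto)
    also have "\<dots> = (\<Sum>r\<in>{r\<in>q ` V. \<kappa>' r = i}. ?w r)"
      by (intro sum.cong) auto
    finally show ?thesis .
  qed
  let ?h = "\<lambda>\<kappa>'. restrict (\<kappa>' \<circ> q) V"
  have rs: "{v\<in>V. ?h \<kappa>' v = i} = {v\<in>V. \<kappa>' (q v) = i}" for \<kappa>' :: "_ \<Rightarrow> nat" and i
    by auto
  have "bij_betw ?h (contents (q ` V) ?w \<alpha>)
      {\<kappa> \<in> contents V w \<alpha>. \<exists>\<kappa>'. \<forall>v\<in>V. \<kappa> v = \<kappa>' (q v)}" (is "bij_betw _ ?A ?B")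
  proof (rule bij_betw_imageI)
    show "inj_on ?h ?A"
    proof (rule inj_onI)
      fix a b assume a: "a \<in> ?A" and b: "b \<in> ?A" and eq: "?h a = ?h b"
      have ab: "a \<in> extensional (q ` V)" "b \<in> extensional (q ` V)"
        using a b by (auto simp: contents_def)
      show "a = b"
      proof (rule extensionalityI[OF ab])
        fix r assume "r \<in> q ` V"
        then obtain v where "v \<in> V" "r = q v" by blast
        then show "a r = b r" using fun_cong[OF eq, of v] by simp
      qed
    qed
    show "?h ` ?A = ?B"
    proof (intro equalityI subsetI)
      fix \<kappa> assume "\<kappa> \<in> ?h ` ?A"
      then obtain \<kappa>' where k': "\<kappa>' \<in> ?A" "\<kappa> = ?h \<kappa>'" by blast
      have "(\<Sum>v\<in>{v\<in>V. \<kappa> v = i}. w v) = \<alpha> i" for i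
        unfolding k'(2) rs group using k'(1) by (simp add: contents_def)
      then have "\<kappa> \<in> contents V w \<alpha>"
        using k'(2) by (simp add: contents_def)
      moreover have "\<forall>v\<in>V. \<kappa> v = \<kappa>' (q v)"
        using k'(2) by simp
      ultimately show "\<kappa> \<in> ?B" by blast
    next
      fix \<kappa> assume k: "\<kappa> \<in> ?B"
      then obtain \<kappa>' where k': "\<forall>v\<in>V. \<kappa> v = \<kappa>' (q v)" by blast
      have ke: "\<kappa> \<in> extensional V" using k by (simp add: contents_def)
      let ?k = "restrict \<kappa>' (q ` V)"
      have h: "?h ?k = \<kappa>"
        using k' ke by (auto simp: extensional_def fun_eq_iff)
      have "\<alpha> i = (\<Sum>r\<in>{r\<in>q ` V. ?k r = i}. ?w r)" for i
      proof -
        have "\<alpha> i = (\<Sum>v\<in>{v\<in>V. ?h ?k v = i}. w v)"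
          unfolding h using k by (simp add: contents_def)
        then show ?thesis unfolding rs group .
      qed
      then have "?k \<in> ?A" unfolding contents_def by simp
      then show "\<kappa> \<in> ?h ` ?A" by (intro image_eqI[where x = ?k]) (simp_all only: h)
    qed
  qed
  then show ?thesis by (simp add: bij_betw_same_card)
qed

text \<open>The power sum p_lambda: without edges, each index \<open>i\<close> picks a colour j
  freely and contributes x_j to the power \<open>lam ! i\<close>, so the series is a product of
  one-part power sums.\<close>

definition psum :: "nat list \<Rightarrow> series" where
  "psum lam = discrete {..<length lam} (\<lambda>i. lam ! i)"

text \<open>Contraction along the injective map \<open>(!) xs\<close>: every colouring factors
  through it and each fibre is a single index.\<close>

lemma discrete_eq_psum:
  assumes "distinct xs"
  shows "discrete (set xs) w = psum (map w xs)"
proof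
  fix \<alpha>
  let ?V = "{..<length xs}"
  have img: "(!) xs ` ?V = set xs"
    by (auto simp: set_conv_nth)
  have fac: "\<exists>\<kappa>'. \<forall>v\<in>?V. \<kappa> v = \<kappa>' (xs ! v)" for \<kappa> :: "nat \<Rightarrow> nat"
  proof -
    have "inj_on ((!) xs) ?V"
      using assms by (simp add: inj_on_def nth_eq_iff_index_eq)
    then show ?thesis
      by (intro exI[of _ "\<lambda>y. \<kappa> (inv_into ?V ((!) xs) y)"]) simp
  qed
  have sw: "(\<Sum>v\<in>{v\<in>?V. xs ! v = r}. w (xs ! v)) = w r" if r: "r \<in> set xs" for r
  proof -
    obtain j where j: "j < length xs" "r = xs ! j"
      using r by (metis in_set_conv_nth)
    then have "{v\<in>?V. xs ! v = r} = {j}"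
      using assms by (auto simp: nth_eq_iff_index_eq)
    then show ?thesis using j by simp
  qed
  have "card (contents ?V (\<lambda>i. map w xs ! i) \<alpha>) = card (contents ?V (\<lambda>i. w (xs ! i)) \<alpha>)"
    by (rule arg_cong[where f = card], rule contents_cong) simp
  also have "\<dots> = card {\<kappa> \<in> contents ?V (\<lambda>i. w (xs ! i)) \<alpha>. \<exists>\<kappa>'. \<forall>v\<in>?V. \<kappa> v = \<kappa>' (xs ! v)}"
    by (rule arg_cong[where f = card]) (use fac in blast)
  also have "\<dots> = card (contents (set xs) (\<lambda>r. \<Sum>v\<in>{v\<in>?V. xs ! v = r}. w (xs ! v)) \<alpha>)"
    unfolding img[symmetric] by (rule card_contents_factoring) simp
  also have "\<dots> = card (contents (set xs) w \<alpha>)"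
    by (rule arg_cong[where f = card], rule contents_cong) (rule sw)
  finally show "discrete (set xs) w \<alpha> = psum (map w xs) \<alpha>"
    by (simp add: psum_def discrete_contents)
qed

lemma discrete_psum_partition:
  assumes "finite W" "\<forall>v\<in>W. w v \<ge> 1"
  shows "\<exists>lam\<in>partitions. length lam = card W \<and> sum_list lam = sum w W \<and> discrete W w = psum lam"
proof -
  obtain ys where ys: "set ys = W" "distinct ys"
    using assms(1) finite_distinct_list by blast
  \<comment> \<open>Listing the vertices by decreasing weight turns the list of weights into a
    partition.\<close>
  define xs where "xs = rev (sort_key w ys)"
  have xs: "set xs = W" "distinct xs"
    using ys by (simp_all add: xs_def)
  have "sorted_wrt (\<ge>) (map w xs)"
    unfolding xs_def rev_map[symmetric] by (simp add: sorted_wrt_rev)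
  moreover have "0 \<notin> set (map w xs)"
    using assms(2) xs by force
  ultimately have "map w xs \<in> partitions"
    by (simp add: partitions_def)
  moreover have "length (map w xs) = card W"
    using xs distinct_card by fastforce
  moreover have "sum_list (map w xs) = sum w W"
    using xs sum_list_distinct_conv_sum_set by blast
  ultimately show ?thesis
    using discrete_eq_psum[OF xs(2), of w] xs(1) by metis
qed

section \<open>Rooted forests\<close>

text \<open>\<open>N\<close> is the set of non-root vertices; the rank \<open>d\<close> decreases from a vertex to its parent and
  so rules out cycles.\<close>

definition rooted_forest ::
    "'v set \<Rightarrow> ('v \<Rightarrow> 'v \<Rightarrow> bool) \<Rightarrow> 'v set \<Rightarrow> ('v \<Rightarrow> 'v) \<Rightarrow> ('v \<Rightarrow> nat) \<Rightarrow> bool" where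
  "rooted_forest V E N par d \<longleftrightarrow> finite V \<and> N \<subseteq> V \<and> (\<forall>v\<in>N. par v \<in> V \<and> d (par v) < d v)
     \<and> (\<forall>x\<in>V. \<forall>y\<in>V. E x y \<longleftrightarrow> x \<in> N \<and> y = par x \<or> y \<in> N \<and> x = par y)"

text \<open>Take the first vertex of a longest path. By maximality its neighbours lie on the path;
  position 0 would be a loop and position 2 or later would close a cycle, so only position 1
  remains. An isolated vertex qualifies with any \<open>u\<close>.\<close>

lemma acyclic_graph_has_leaf:
  assumes G: "simple_graph V E" and "V \<noteq> {}" and acyclic: "\<nexists>xs. is_cycle V E xs"
  shows "\<exists>v\<in>V. \<exists>u. \<forall>y. E v y \<longrightarrow> y = u"
proof -
  let ?P = "\<lambda>xs. xs \<noteq> [] \<and> distinct xs \<and> set xs \<subseteq> V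
    \<and> (\<forall>i. Suc i < length xs \<longrightarrow> E (xs ! i) (xs ! Suc i))"
  have fin: "finite V" and sym: "\<And>x y. E x y \<Longrightarrow> E y x" and irr: "\<And>x. \<not> E x x"
    and EV: "\<And>x y. E x y \<Longrightarrow> x \<in> V \<and> y \<in> V"
    using G by (auto simp: simple_graph_def)
  obtain a where "a \<in> V" using \<open>V \<noteq> {}\<close> by blast
  then have "?P [a]" by simp
  moreover have "\<forall>xs. ?P xs \<longrightarrow> length xs < Suc (card V)"
    using fin by (metis card_mono distinct_card less_Suc_eq_le)
  ultimately have "\<exists>xs. ?P xs \<and> (\<forall>ys. ?P ys \<longrightarrow> length ys \<le> length xs)"
    by (rule ex_has_greatest_nat)
  then obtain xs where P: "?P xs" and max: "\<And>ys. ?P ys \<Longrightarrow> length ys \<le> length xs"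
    by (elim exE conjE) blast
  have "y = xs ! 1" if y: "E (hd xs) y" for y
  proof -
    have "y \<in> set xs"
    proof (rule ccontr)
      assume "y \<notin> set xs"
      have "E ((y # xs) ! i) ((y # xs) ! Suc i)" if "Suc i < length (y # xs)" for i
        using that P y by (cases i) (auto simp: hd_conv_nth intro: sym)
      then have "?P (y # xs)"
        using P \<open>y \<notin> set xs\<close> EV[OF y] by simp
      from max[OF this] show False by simp
    qed
    then obtain i where i: "i < length xs" "xs ! i = y"
      by (metis in_set_conv_nth)
    have hd: "hd xs = xs ! 0" using P by (simp add: hd_conv_nth)
    have "i \<noteq> 0" using y irr i hd by metis
    moreover have "\<not> i \<ge> 2"
    proof
      assume "i \<ge> 2"
      \<comment> \<open>The initial segment up to the neighbour, closed by the edge back to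
        \<open>hd xs\<close>.\<close>
      let ?c = "take (Suc i) xs"
      have len: "length ?c = Suc i" using i by simp
      have "last ?c = y" using i by (simp add: take_Suc_conv_app_nth)
      moreover have "hd ?c = hd xs" by simp
      moreover have "distinct ?c" using P by simp
      moreover have "set ?c \<subseteq> V" using P set_take_subset[of "Suc i" xs] by blast
      moreover have "E (?c ! j) (?c ! Suc j)" if "Suc j < length ?c" for j
        using that P i by simp
      ultimately have "is_cycle V E ?c"
        unfolding is_cycle_def len using \<open>i \<ge> 2\<close> sym[OF y] len by simp
      then show False using acyclic by blast
    qed
    ultimately have "i = 1" by simp
    then show ?thesis using i by simp
  qed
  moreover have "hd xs \<in> V" using P by auto
  ultimately show ?thesis by blast
qed

text \<open>Induction on the vertex set, removing a leaf. The leaf is put back below its neighbour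
  with rank one larger, or as a new root if it is isolated.\<close>

lemma acyclic_graph_rooted_forest:
  assumes "simple_graph V E" "\<nexists>xs. is_cycle V E xs"
  shows "\<exists>N par d. rooted_forest V E N par d"
proof -
  have "finite V" using assms(1) by (simp add: simple_graph_def)
  then show ?thesis using assms
  proof (induction V arbitrary: E rule: finite_psubset_induct)
    case (psubset V)
    show ?case
    proof (cases "V = {}")
      case True
      then show ?thesis by (auto simp: rooted_forest_def)
    next
      case False
      from acyclic_graph_has_leaf[OF psubset.prems(1) False psubset.prems(2)]
      obtain v u where v: "v \<in> V" and u: "\<And>y. E v y \<Longrightarrow> y = u" by blast
      have sym: "\<And>x y. E x y \<Longrightarrow> E y x" and irr: "\<And>x. \<not> E x x"
        and EV: "\<And>x y. E x y \<Longrightarrow> x \<in> V \<and> y \<in> V"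
        using psubset.prems(1) by (auto simp: simple_graph_def)
      define E' where "E' x y \<longleftrightarrow> E x y \<and> x \<noteq> v \<and> y \<noteq> v" for x y
      have "simple_graph (V - {v}) E'"
        using psubset.prems(1) by (auto simp: simple_graph_def E'_def)
      moreover have "\<nexists>xs. is_cycle (V - {v}) E' xs"
        using psubset.prems(2) by (fastforce simp: is_cycle_def E'_def)
      ultimately obtain N par d where F: "rooted_forest (V - {v}) E' N par d"
        using psubset.IH[of "V - {v}" E'] v by blast
      have vN: "v \<notin> N" using F by (auto simp: rooted_forest_def)
      have FN: "N \<subseteq> V" and Fp: "\<And>x. x \<in> N \<Longrightarrow> par x \<in> V \<and> par x \<noteq> v \<and> d (par x) < d x"
        and FE: "\<And>x y. \<lbrakk>x \<in> V; y \<in> V; x \<noteq> v; y \<noteq> v\<rbrakk> \<Longrightarrow>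
          E x y \<longleftrightarrow> x \<in> N \<and> y = par x \<or> y \<in> N \<and> x = par y"
        using F by (auto simp: rooted_forest_def E'_def)
      show ?thesis
      proof (cases "\<exists>y. E v y")
        case True
        then have vu: "E v u" using u by blast
        then have uV: "u \<in> V" "u \<noteq> v" using EV irr by auto
        let ?par = "par(v := u)" and ?d = "d(v := Suc (d u))"
        have "E x y \<longleftrightarrow> x \<in> insert v N \<and> y = ?par x \<or> y \<in> insert v N \<and> x = ?par y"
          if "x \<in> V" "y \<in> V" for x y
        proof (cases "x = v \<or> y = v")
          case True
          then consider "x = v" "y = v" | "x = v" "y \<noteq> v" | "x \<noteq> v" "y = v" by blast
          then show ?thesis
          proof cases
            case 1
            then show ?thesis using irr uV by simp
          next
            case 2
            then have "E x y \<longleftrightarrow> y = u" using u vu by blast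
            then show ?thesis using 2 Fp[of y] by auto
          next
            case 3
            then have "E x y \<longleftrightarrow> x = u" using u[of x] vu sym by blast
            then show ?thesis using 3 Fp[of x] by auto
          qed
        next
          case False
          then show ?thesis using FE[OF that] by auto
        qed
        then have "rooted_forest V E (insert v N) ?par ?d"
          using v FN Fp uV psubset.hyps vN unfolding rooted_forest_def by auto
        then show ?thesis by blast
      next
        case False
        then have "rooted_forest V E N par d"
          using FN Fp FE vN psubset.hyps sym unfolding rooted_forest_def by metis
        then show ?thesis by blast
      qed
    qed
  qed
qed

text \<open>The subforest with edges \<open>{v, par v}\<close>, \<open>v \<in> S\<close>, has exactly one vertex outside \<open>S\<close>
  in each component; \<open>q\<close> sends a vertex to that representative of its component.\<close>

lemma rooted_forest_retraction:
  assumes F: "rooted_forest V E N par d" and S: "S \<subseteq> N"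
  shows "\<exists>q. (\<forall>v\<in>V. q v \<in> V - S) \<and> (\<forall>v\<in>V - S. q v = v) \<and> (\<forall>v\<in>S. q (par v) = q v)
    \<and> (\<forall>\<kappa> :: 'v \<Rightarrow> nat. (\<forall>v\<in>S. \<kappa> v = \<kappa> (par v)) \<longrightarrow> (\<forall>v. \<kappa> (q v) = \<kappa> v))"
proof -
  have fin: "finite V" and SV: "S \<subseteq> V" and par: "\<And>v. v \<in> S \<Longrightarrow> par v \<in> V \<and> d (par v) < d v"
    using F S by (auto simp: rooted_forest_def)
  define p where "p v = (if v \<in> S then par v else v)" for v
  have dM: "d v \<le> Max (d ` V)" if "v \<in> V" for v
    using fin that by simp
  \<comment> \<open>Each application of \<open>p\<close> inside \<open>S\<close> lowers the rank, so
    one application more than the largest rank is sure to leave \<open>S\<close>; from then on the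
    point is fixed.\<close>
  define q where "q = p ^^ Suc (Max (d ` V))"
  have fix': "(p ^^ k) v = v" if "v \<notin> S" for k v
    using that by (induction k) (auto simp: p_def)
  have iter: "(p ^^ k) v \<in> V - S" if "v \<in> V" "d v < k" for k v
    using that
  proof (induction k arbitrary: v)
    case (Suc k)
    show ?case
    proof (cases "v \<in> S")
      case True
      then have "(p ^^ k) (par v) \<in> V - S"
        using par[OF True] Suc by (intro Suc.IH) auto
      moreover have "p v = par v" using True by (simp add: p_def)
      ultimately show ?thesis by (simp add: funpow_swap1)
    next
      case False
      then show ?thesis using fix'[of v "Suc k"] Suc.prems by simp
    qed
  qed simp
  have q1: "q v \<in> V - S" if "v \<in> V" for v
    unfolding q_def using that dM[OF that] by (intro iter) auto
  have q2: "q v = v" if "v \<in> V - S" for v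
    using that fix' unfolding q_def by blast
  have q3: "q (par v) = q v" if "v \<in> S" for v
  proof -
    \<comment> \<open>\<open>q\<close> is an iterate of \<open>p\<close>, hence commutes with it,
      and its values are already fixed by \<open>p\<close>.\<close>
    have "q (p v) = p (q v)" unfolding q_def by (simp add: funpow_swap1)
    also have "p (q v) = q v" using q1[of v] that SV by (auto simp: p_def)
    finally show ?thesis using that by (simp add: p_def)
  qed
  have q4: "\<kappa> (q v) = \<kappa> v" if k: "\<forall>v\<in>S. \<kappa> v = \<kappa> (par v)" for \<kappa> :: "_ \<Rightarrow> nat" and v
  proof -
    have "\<kappa> (p v) = \<kappa> v" for v using k by (simp add: p_def)
    then have "\<kappa> ((p ^^ k) v) = \<kappa> v" for k by (induction k) auto
    then show ?thesis unfolding q_def .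
  qed
  show ?thesis
    by (rule exI[of _ q]) (use q1 q2 q3 q4 in blast)
qed

text \<open>The form in which trees enter the counting. Paths meet it through an explicit parent
  map, arbitrary trees through \<open>tree_imp_rooted_tree\<close>.\<close>

definition rooted_tree :: "'v set \<Rightarrow> ('v \<Rightarrow> 'v \<Rightarrow> bool) \<Rightarrow> bool" where
  "rooted_tree V E \<longleftrightarrow> simple_graph V E \<and> (\<exists>r par d. r \<in> V \<and> rooted_forest V E (V - {r}) par d)"

text \<open>Retract along all edges of a rooted forest. The retraction is constant along edges,
  hence on a connected vertex set, yet it fixes every root; so there is just one root.\<close>

lemma tree_imp_rooted_tree:
  assumes "tree V E"
  shows "rooted_tree V E"
proof -
  have G: "simple_graph V E" and ne: "V \<noteq> {}" and conn: "connected_graph V E"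
    and "\<nexists>xs. is_cycle V E xs"
    using assms by (auto simp: tree_def)
  then obtain N par d where F: "rooted_forest V E N par d"
    using acyclic_graph_rooted_forest by blast
  then have NV: "N \<subseteq> V" and FE: "\<And>x y. \<lbrakk>x \<in> V; y \<in> V; E x y\<rbrakk> \<Longrightarrow> x \<in> N \<and> y = par x \<or> y \<in> N \<and> x = par y"
    by (auto simp: rooted_forest_def)
  obtain q where q1: "\<forall>v\<in>V. q v \<in> V - N" and q2: "\<forall>v\<in>V - N. q v = v"
    and q3: "\<forall>v\<in>N. q (par v) = q v"
    using rooted_forest_retraction[OF F order.refl] by blast
  have const: "q u = q v" if "u \<in> V" "v \<in> V" for u v
  proof -
    have "(\<lambda>x y. E x y \<and> x \<in> V \<and> y \<in> V)\<^sup>*\<^sup>* u v"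
      using conn that by (simp add: connected_graph_def)
    then show ?thesis
      by (induction rule: rtranclp_induct) (use FE q3 in metis)+
  qed
  obtain a where a: "a \<in> V" using ne by blast
  have "N = V - {q a}"
  proof -
    have "x = q a" if "x \<in> V - N" for x
      using const[of x a] q2 that a by auto
    then show ?thesis using NV q1 a by blast
  qed
  then show ?thesis using F q1 a G unfolding rooted_tree_def by blast
qed

text \<open>The edges are indexed by the non-root vertices, so the indicator of properness is the
  product over \<open>N\<close> of one minus the indicator of
  \<open>\<kappa> v = \<kappa> (par v)\<close>. Expand it and exchange the two sums.\<close>

lemma chrom_rooted_forest_subsets:
  assumes F: "rooted_forest V E N par d" and w: "\<forall>v\<in>V. w v \<ge> 1"
  shows "chrom V E w \<alpha> = (\<Sum>S\<in>Pow N. (-1) ^ card S *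
    of_nat (card {\<kappa> \<in> contents V w \<alpha>. \<forall>v\<in>S. \<kappa> v = \<kappa> (par v)}))"
proof -
  have fin: "finite V" and NV: "N \<subseteq> V" and par: "\<And>v. v \<in> N \<Longrightarrow> par v \<in> V"
    and FE: "\<And>x y. \<lbrakk>x \<in> V; y \<in> V\<rbrakk> \<Longrightarrow> E x y \<longleftrightarrow> x \<in> N \<and> y = par x \<or> y \<in> N \<and> x = par y"
    using F by (auto simp: rooted_forest_def)
  have finN: "finite N" using NV fin by (rule finite_subset)
  let ?C = "contents V w \<alpha>"
  have finC: "finite ?C" using fin w by (rule finite_contents)
  have count: "of_nat (card {\<kappa> \<in> ?C. P \<kappa>}) = (\<Sum>\<kappa>\<in>?C. of_bool (P \<kappa>) :: rat)" for P
    using finC by (simp add: of_bool_def sum.If_cases Int_def)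
  have all: "(\<Prod>v\<in>S. of_bool (P v) :: rat) = of_bool (\<forall>v\<in>S. P v)" if "finite S" for P and S :: "'a set"
    using that by (induction S) auto
  have proper: "(\<forall>u\<in>V. \<forall>v\<in>V. E u v \<longrightarrow> \<kappa> u \<noteq> \<kappa> v) \<longleftrightarrow> (\<forall>v\<in>N. \<kappa> v \<noteq> \<kappa> (par v))" for \<kappa> :: "_ \<Rightarrow> nat"
  proof
    assume l: "\<forall>u\<in>V. \<forall>v\<in>V. E u v \<longrightarrow> \<kappa> u \<noteq> \<kappa> v"
    show "\<forall>v\<in>N. \<kappa> v \<noteq> \<kappa> (par v)"
    proof
      fix v assume "v \<in> N"
      then show "\<kappa> v \<noteq> \<kappa> (par v)" using l FE par NV by blast
    qed
  next
    assume r: "\<forall>v\<in>N. \<kappa> v \<noteq> \<kappa> (par v)"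
    show "\<forall>u\<in>V. \<forall>v\<in>V. E u v \<longrightarrow> \<kappa> u \<noteq> \<kappa> v"
    proof (intro ballI impI)
      fix u v assume "u \<in> V" "v \<in> V" "E u v"
      then show "\<kappa> u \<noteq> \<kappa> v" using FE[of u v] r by metis
    qed
  qed
  have incl_excl: "(of_bool (\<forall>v\<in>N. \<kappa> v \<noteq> \<kappa> (par v)) :: rat)
      = (\<Sum>S\<in>Pow N. (-1) ^ card S * of_bool (\<forall>v\<in>S. \<kappa> v = \<kappa> (par v)))" for \<kappa> :: "_ \<Rightarrow> nat"
  proof -
    have "(of_bool (\<forall>v\<in>N. \<kappa> v \<noteq> \<kappa> (par v)) :: rat) = (\<Prod>v\<in>N. of_bool (\<kappa> v \<noteq> \<kappa> (par v)))"
      using all[OF finN] by simp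
    also have "\<dots> = (\<Prod>v\<in>N. 1 - of_bool (\<kappa> v = \<kappa> (par v)))"
      by (intro prod.cong) auto
    also have "\<dots> = (\<Sum>S\<in>Pow N. (-1) ^ card S * (\<Prod>v\<in>S. of_bool (\<kappa> v = \<kappa> (par v))))"
      by (simp add: prod_diff_conv_sum[OF finN])
    also have "\<dots> = (\<Sum>S\<in>Pow N. (-1) ^ card S * of_bool (\<forall>v\<in>S. \<kappa> v = \<kappa> (par v)))"
      using finite_subset[OF _ finN] by (intro sum.cong refl) (simp add: all)
    finally show ?thesis .
  qed
  have "chrom V E w \<alpha> = (\<Sum>\<kappa>\<in>?C. of_bool (\<forall>v\<in>N. \<kappa> v \<noteq> \<kappa> (par v)))"
    unfolding chrom_contents proper count ..
  also have "\<dots> = (\<Sum>\<kappa>\<in>?C. \<Sum>S\<in>Pow N. (-1) ^ card S * of_bool (\<forall>v\<in>S. \<kappa> v = \<kappa> (par v)))"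
    unfolding incl_excl ..
  also have "\<dots> = (\<Sum>S\<in>Pow N. \<Sum>\<kappa>\<in>?C. (-1) ^ card S * of_bool (\<forall>v\<in>S. \<kappa> v = \<kappa> (par v)))"
    by (rule sum.swap)
  also have "\<dots> = (\<Sum>S\<in>Pow N. (-1) ^ card S *
      of_nat (card {\<kappa> \<in> ?C. \<forall>v\<in>S. \<kappa> v = \<kappa> (par v)}))"
    unfolding count sum_distrib_left ..
  finally show ?thesis .
qed

section \<open>Power sum expansion of a union of trees\<close>

text \<open>Equality of colours along the edges of \<open>S\<close> amounts to factoring through the
  retraction, so \<open>card_contents_factoring\<close> applies. Each representative then carries
  the weight of its component.\<close>

lemma subforest_retraction:
  assumes F: "rooted_forest V E N par d" and S: "S \<subseteq> N"
  shows "\<exists>q. (\<forall>v\<in>V. q v \<in> V - S) \<and> (\<forall>v\<in>V - S. q v = v)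
    \<and> (\<forall>\<kappa> :: 'v \<Rightarrow> nat. (\<forall>v\<in>S. \<kappa> v = \<kappa> (par v)) \<longrightarrow> (\<forall>v. \<kappa> (q v) = \<kappa> v))
    \<and> (\<forall>\<alpha>. card {\<kappa> \<in> contents V w \<alpha>. \<forall>v\<in>S. \<kappa> v = \<kappa> (par v)}
        = card (contents (V - S) (\<lambda>r. \<Sum>v\<in>{v\<in>V. q v = r}. w v) \<alpha>))"
proof -
  have fin: "finite V" and SV: "S \<subseteq> V" and par: "\<And>v. v \<in> S \<Longrightarrow> par v \<in> V"
    using F S by (auto simp: rooted_forest_def)
  obtain q where q1: "\<forall>v\<in>V. q v \<in> V - S" and q2: "\<forall>v\<in>V - S. q v = v"
    and q3: "\<forall>v\<in>S. q (par v) = q v"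
    and q4: "\<forall>\<kappa> :: 'v \<Rightarrow> nat. (\<forall>v\<in>S. \<kappa> v = \<kappa> (par v)) \<longrightarrow> (\<forall>v. \<kappa> (q v) = \<kappa> v)"
    using rooted_forest_retraction[OF F S] by blast
  have img: "q ` V = V - S"
  proof
    show "q ` V \<subseteq> V - S" using q1 by blast
    show "V - S \<subseteq> q ` V" using q2 by (metis Diff_iff image_eqI subsetI)
  qed
  have "(\<forall>v\<in>S. \<kappa> v = \<kappa> (par v)) \<longleftrightarrow> (\<exists>\<kappa>'. \<forall>v\<in>V. \<kappa> v = \<kappa>' (q v))" for \<kappa> :: "'v \<Rightarrow> nat"
  proof
    assume "\<forall>v\<in>S. \<kappa> v = \<kappa> (par v)"
    then have "\<forall>v\<in>V. \<kappa> v = \<kappa> (q v)" using q4 by metis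
    then show "\<exists>\<kappa>'. \<forall>v\<in>V. \<kappa> v = \<kappa>' (q v)" by blast
  next
    assume "\<exists>\<kappa>'. \<forall>v\<in>V. \<kappa> v = \<kappa>' (q v)"
    then obtain \<kappa>' where k: "\<forall>v\<in>V. \<kappa> v = \<kappa>' (q v)" by blast
    show "\<forall>v\<in>S. \<kappa> v = \<kappa> (par v)"
    proof
      fix v assume "v \<in> S"
      then show "\<kappa> v = \<kappa> (par v)" using k q3 par SV by (metis subsetD)
    qed
  qed
  then have "\<forall>\<alpha>. card {\<kappa> \<in> contents V w \<alpha>. \<forall>v\<in>S. \<kappa> v = \<kappa> (par v)}
        = card (contents (V - S) (\<lambda>r. \<Sum>v\<in>{v\<in>V. q v = r}. w v) \<alpha>)"
    using card_contents_factoring[OF fin, of w _ q] unfolding img by simp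
  then show ?thesis using q1 q2 q4 by blast
qed

text \<open>What is used about a forest with component sizes \<open>lam\<close>. The unique shortest
  term gives triangularity. The last clause says that replacing each p_nu by x to its length yields
  the chromatic polynomial x^k (x-1)^(n-k) of the forest.\<close>

definition psum_expansion :: "series \<Rightarrow> nat list \<Rightarrow> (nat list \<Rightarrow> rat) \<Rightarrow> bool" where
  "psum_expansion f lam c \<longleftrightarrow> coeff_family c \<and> f = lincomb c psum \<and> c lam \<noteq> 0
     \<and> (\<forall>nu. c nu \<noteq> 0 \<longrightarrow> sum_list nu = sum_list lam \<and> (length nu \<le> length lam \<longrightarrow> nu = lam))
     \<and> (\<forall>x. (\<Sum>nu\<in>{nu. c nu \<noteq> 0}. c nu * x ^ length nu)
          = x ^ length lam * (x - 1) ^ (sum_list lam - length lam))"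

text \<open>Here \<open>A\<close> stands for the edge set and \<open>sh S\<close> for the component
  sizes when only the edges in \<open>S\<close> are kept. Every edge lowers the length by one, so
  only the full set gets down to the length of \<open>lam\<close>.\<close>

lemma psum_expansionI:
  assumes A: "finite A" "card A + length lam = sum_list lam"
    and sh: "\<And>S. S \<subseteq> A \<Longrightarrow> sh S \<in> partitions \<and> length (sh S) + card S = sum_list lam
      \<and> sum_list (sh S) = sum_list lam"
    and shA: "sh A = lam"
    and f: "\<And>\<alpha>. f \<alpha> = (\<Sum>S\<in>Pow A. (-1) ^ card S * psum (sh S) \<alpha>)"
  shows "\<exists>c. psum_expansion f lam c"
proof -
  define c :: "nat list \<Rightarrow> rat" where "c nu = (\<Sum>S\<in>{S\<in>Pow A. sh S = nu}. (-1) ^ card S)" for nu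
  have finP: "finite (Pow A)" using A by simp
  have supp: "\<exists>S\<subseteq>A. sh S = nu" if "c nu \<noteq> 0" for nu
  proof -
    have "{S\<in>Pow A. sh S = nu} \<noteq> {}"
      using that unfolding c_def by (metis sum.empty)
    then show ?thesis by blast
  qed
  then have sub: "{nu. c nu \<noteq> 0} \<subseteq> sh ` Pow A" by blast
  have eval: "(\<Sum>nu\<in>{nu. c nu \<noteq> 0}. c nu * g nu) = (\<Sum>S\<in>Pow A. (-1) ^ card S * g (sh S))"
    for g :: "nat list \<Rightarrow> rat"
  proof -
    have "(\<Sum>nu\<in>{nu. c nu \<noteq> 0}. c nu * g nu) = (\<Sum>nu\<in>sh ` Pow A. c nu * g nu)"
      by (rule sum.mono_neutral_left) (use sub finP in auto)
    also have "\<dots> = (\<Sum>nu\<in>sh ` Pow A. \<Sum>S\<in>{S\<in>Pow A. sh S = nu}. (-1) ^ card S * g (sh S))"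
      unfolding c_def sum_distrib_right by (intro sum.cong) auto
    also have "\<dots> = (\<Sum>S\<in>Pow A. (-1) ^ card S * g (sh S))"
      by (rule sum.image_gen[symmetric]) fact
    finally show ?thesis .
  qed
  have only: "S = A" if "S \<subseteq> A" "length (sh S) \<le> length lam" for S
    using that sh[OF that(1)] A by (intro card_seteq) auto
  have "coeff_family c"
    unfolding coeff_family_def
  proof
    show "finite {nu. c nu \<noteq> 0}" using sub finP by (metis finite_surj)
    show "{nu. c nu \<noteq> 0} \<subseteq> partitions" using sub sh by blast
  qed
  moreover have "f = lincomb c psum"
    unfolding lincomb_def eval using f by blast
  moreover have "c lam \<noteq> 0"
  proof -
    have "S = A" if "S \<subseteq> A" "sh S = lam" for S
      using only[of S] that by simp
    then have "{S\<in>Pow A. sh S = lam} = {A}" using shA by blast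
    then show ?thesis by (simp add: c_def)
  qed
  moreover have "sum_list nu = sum_list lam \<and> (length nu \<le> length lam \<longrightarrow> nu = lam)"
    if "c nu \<noteq> 0" for nu
    using supp[OF that] sh only shA by metis
  moreover have "(\<Sum>nu\<in>{nu. c nu \<noteq> 0}. c nu * x ^ length nu)
      = x ^ length lam * (x - 1) ^ (sum_list lam - length lam)" for x
  proof -
    \<comment> \<open>The power of \<open>x\<close> with exponent \<open>card (A - S)\<close> is
      written as a product over \<open>A - S\<close>, so that the sum becomes the expansion of a
      product of factors \<open>x - 1\<close>.\<close>
    have "(\<Sum>nu\<in>{nu. c nu \<noteq> 0}. c nu * x ^ length nu)
        = (\<Sum>S\<in>Pow A. x ^ length lam * ((-1) ^ card S * (\<Prod>v\<in>S. 1) * (\<Prod>v\<in>A - S. x)))"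
      unfolding eval
    proof (intro sum.cong refl)
      fix S assume "S \<in> Pow A"
      then have S: "S \<subseteq> A" by simp
      have "card (A - S) + card S = card A"
        using S A(1) by (metis card_Diff_subset card_mono finite_subset le_add_diff_inverse2)
      then have "length (sh S) = length lam + card (A - S)"
        using sh[OF S] A by linarith
      then show "(-1) ^ card S * x ^ length (sh S)
          = x ^ length lam * ((-1) ^ card S * (\<Prod>v\<in>S. 1) * (\<Prod>v\<in>A - S. x))"
        by (simp add: power_add)
    qed
    also have "\<dots> = x ^ length lam * (\<Prod>v\<in>A. x - 1)"
      unfolding prod_diff_conv_sum[OF A(1)] sum_distrib_left ..
    also have "\<dots> = x ^ length lam * (x - 1) ^ (sum_list lam - length lam)"
      using A(2) by (simp flip: A(2))
    finally show ?thesis .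
  qed
  ultimately show ?thesis unfolding psum_expansion_def by blast
qed

lemma simple_graph_union:
  assumes "\<forall>n\<in>set lam. simple_graph (TV n) (TE n)"
  shows "simple_graph (union_V TV lam) (union_E TE lam)"
proof -
  have G: "simple_graph (TV (lam ! i)) (TE (lam ! i))" if "i < length lam" for i
    using assms that by simp
  have "union_V TV lam = Sigma {..<length lam} (\<lambda>i. TV (lam ! i))"
    by (auto simp: union_V_def)
  moreover have "finite (TV (lam ! i))" if "i < length lam" for i
    using G[OF that] by (simp add: simple_graph_def)
  ultimately have "finite (union_V TV lam)" by auto
  then show ?thesis
    using G unfolding simple_graph_def union_V_def union_E_def by auto
qed

lemma card_union_V:
  assumes "\<forall>n\<in>set lam. finite (TV n) \<and> card (TV n) = n"
  shows "card (union_V TV lam) = sum_list lam"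
proof -
  have "union_V TV lam = Sigma {..<length lam} (\<lambda>i. TV (lam ! i))"
    by (auto simp: union_V_def)
  then have "card (union_V TV lam) = (\<Sum>i<length lam. card (TV (lam ! i)))"
    using assms by simp
  also have "\<dots> = (\<Sum>i<length lam. lam ! i)"
    using assms by (intro sum.cong) auto
  also have "\<dots> = sum_list lam"
    by (simp add: sum_list_sum_nth atLeast0LessThan)
  finally show ?thesis .
qed

text \<open>A disjoint union of rooted trees is a rooted forest with one root per part. Contracting
  an edge set \<open>S\<close> leaves an edgeless graph weighted by component sizes, whose series is
  a power sum.\<close>

lemma chrom_union_trees_expansion:
  fixes TV :: "nat \<Rightarrow> 'b set"
  assumes T: "\<forall>n\<ge>1. rooted_tree (TV n) (TE n) \<and> card (TV n) = n" and lam: "lam \<in> partitions"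
  shows "\<exists>c. psum_expansion (chrom (union_V TV lam) (union_E TE lam) (\<lambda>_. 1)) lam c"
proof -
  let ?V = "union_V TV lam" and ?E = "union_E TE lam"
  have pos: "n \<ge> 1" if "n \<in> set lam" for n
    using lam that by (cases n) (auto simp: partitions_def)
  have "\<forall>n. \<exists>r par d. n \<ge> 1 \<longrightarrow> r \<in> TV n \<and> rooted_forest (TV n) (TE n) (TV n - {r}) par d"
    using T unfolding rooted_tree_def by metis
  then obtain r par d where
    R: "\<And>n. n \<ge> 1 \<Longrightarrow> r n \<in> TV n \<and> rooted_forest (TV n) (TE n) (TV n - {r n}) (par n) (d n)"
    by metis
  define N where "N = {(i, v). i < length lam \<and> v \<in> TV (lam ! i) - {r (lam ! i)}}"
  define p where "p x = (fst x, par (lam ! fst x) (snd x))" for x :: "nat \<times> 'b"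
  define e where "e x = d (lam ! fst x) (snd x)" for x :: "nat \<times> 'b"
  have G: "simple_graph ?V ?E"
    using T pos by (intro simple_graph_union) (auto simp: rooted_tree_def)
  then have fin: "finite ?V" by (simp add: simple_graph_def)
  have card: "card ?V = sum_list lam"
    using T pos by (intro card_union_V) (auto simp: rooted_tree_def simple_graph_def)
  have Ri: "r (lam ! i) \<in> TV (lam ! i)"
      "rooted_forest (TV (lam ! i)) (TE (lam ! i)) (TV (lam ! i) - {r (lam ! i)}) (par (lam ! i)) (d (lam ! i))"
    if "i < length lam" for i
    using R[of "lam ! i"] pos that by auto
  have F: "rooted_forest ?V ?E N p e"
    unfolding rooted_forest_def
  proof (intro conjI ballI)
    show "finite ?V" by fact
    show "N \<subseteq> ?V" by (auto simp: N_def union_V_def)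
  next
    fix x assume "x \<in> N"
    then show "p x \<in> ?V" "e (p x) < e x"
      using Ri(2)[of "fst x"] by (auto simp: N_def union_V_def p_def e_def rooted_forest_def)
  next
    fix x y assume "x \<in> ?V" "y \<in> ?V"
    then show "?E x y \<longleftrightarrow> x \<in> N \<and> y = p x \<or> y \<in> N \<and> x = p y"
      using Ri(2)[of "fst x"]
      by (cases x; cases y) (auto simp: N_def union_V_def union_E_def p_def rooted_forest_def)
  qed
  then have NV: "N \<subseteq> ?V" by (simp add: rooted_forest_def)
  have finN: "finite N" using NV fin by (rule finite_subset)
  \<comment> \<open>The roots are listed in the order of the parts, so that contracting all edges
    yields \<open>lam\<close> itself and not a rearrangement.\<close>
  define xs where "xs = map (\<lambda>i. (i, r (lam ! i))) [0..<length lam]"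
  have xs: "distinct xs" "set xs = ?V - N"
    using Ri(1) by (auto simp: xs_def distinct_map inj_on_def N_def union_V_def)
  have "card N + length lam = sum_list lam"
  proof -
    have "card (?V - N) = length lam"
      using distinct_card[OF xs(1)] xs(2) by (simp add: xs_def)
    then show ?thesis
      using card card_Diff_subset[OF finN NV] card_mono[OF fin NV] by linarith
  qed
  let ?K = "\<lambda>S \<alpha>. card {\<kappa> \<in> contents ?V (\<lambda>_. 1) \<alpha>. \<forall>v\<in>S. \<kappa> v = \<kappa> (p v)}"
  have "\<exists>nu. nu \<in> partitions \<and> length nu + card S = sum_list lam \<and> sum_list nu = sum_list lam
      \<and> (\<forall>\<alpha>. of_nat (?K S \<alpha>) = psum nu \<alpha>) \<and> (S = N \<longrightarrow> nu = lam)" if S: "S \<subseteq> N" for S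
  proof -
    have finS: "finite S" using S finN by (rule finite_subset)
    obtain q where q1: "\<forall>v\<in>?V. q v \<in> ?V - S" and q2: "\<forall>v\<in>?V - S. q v = v"
      and q3: "\<forall>\<kappa> :: nat \<times> 'b \<Rightarrow> nat. (\<forall>v\<in>S. \<kappa> v = \<kappa> (p v)) \<longrightarrow> (\<forall>v. \<kappa> (q v) = \<kappa> v)"
      and q4: "\<forall>\<alpha>. ?K S \<alpha> = card (contents (?V - S) (\<lambda>r. \<Sum>v\<in>{v\<in>?V. q v = r}. 1) \<alpha>)"
      using subforest_retraction[OF F S, of "\<lambda>_. 1"] by blast
    let ?w = "\<lambda>r. \<Sum>v\<in>{v\<in>?V. q v = r}. 1 :: nat"
    have w1: "?w v \<ge> 1" if "v \<in> ?V - S" for v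
    proof -
      have "v \<in> {u\<in>?V. q u = v}" using that q2 by simp
      moreover have "finite {u\<in>?V. q u = v}" using fin by simp
      ultimately have "card {u\<in>?V. q u = v} > 0" by (metis card_gt_0_iff empty_iff)
      then show ?thesis by simp
    qed
    have sw: "sum ?w (?V - S) = sum_list lam"
    proof -
      have "sum ?w (?V - S) = (\<Sum>v\<in>?V. 1)"
        by (rule sum.group) (use fin q1 in auto)
      then show ?thesis using card by simp
    qed
    have cS: "card (?V - S) + card S = sum_list lam"
      using S NV fin finS card by (metis card_Diff_subset card_mono le_add_diff_inverse2 order_trans)
    have K: "of_nat (?K S \<alpha>) = discrete (?V - S) ?w \<alpha>" for \<alpha>
      using q4 by (simp add: discrete_contents)
    show ?thesis
    proof (cases "S = N")
      case False
      obtain nu where "nu \<in> partitions" "length nu = card (?V - S)" "sum_list nu = sum ?w (?V - S)"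
          "discrete (?V - S) ?w = psum nu"
        using discrete_psum_partition[of "?V - S" ?w] fin w1 by blast
      then show ?thesis using False sw cS K by (intro exI[of _ nu]) simp
    next
      case True
      \<comment> \<open>The first coordinate is itself a colouring constant along all edges, so the
        retraction cannot leave a summand of the union.\<close>
      have "fst (q v) = fst v" for v
        using q3[rule_format, of fst v] by (simp add: p_def)
      have "map ?w xs = lam"
      proof (rule nth_equalityI)
        show "length (map ?w xs) = length lam" by (simp add: xs_def)
        fix i assume "i < length (map ?w xs)"
        then have i: "i < length lam" by (simp add: xs_def)
        have "q v = (i, r (lam ! i)) \<longleftrightarrow> fst v = i" if "v \<in> ?V" for v
        proof -
          have "q v \<in> set xs" using q1 that True xs by blast
          then have "q v = (fst (q v), r (lam ! fst (q v)))" by (auto simp: xs_def)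
          then show ?thesis using \<open>fst (q v) = fst v\<close> by auto
        qed
        then have "{v\<in>?V. q v = (i, r (lam ! i))} = Pair i ` TV (lam ! i)"
          using i by (auto simp: union_V_def)
        then have "card {v\<in>?V. q v = (i, r (lam ! i))} = card (TV (lam ! i))"
          by (simp add: card_image inj_on_def)
        also have "\<dots> = lam ! i"
          using T pos i by simp
        finally show "map ?w xs ! i = lam ! i"
          using i by (simp add: xs_def)
      qed
      then have "discrete (?V - S) ?w = psum lam"
        using discrete_eq_psum[OF xs(1), of ?w] True xs(2) by simp
      then show ?thesis
        using True lam K \<open>card N + length lam = sum_list lam\<close> by (intro exI[of _ lam]) simp
    qed
  qed
  then have "\<forall>S\<in>Pow N. \<exists>nu. nu \<in> partitions \<and> length nu + card S = sum_list lam
      \<and> sum_list nu = sum_list lam \<and> (\<forall>\<alpha>. of_nat (?K S \<alpha>) = psum nu \<alpha>) \<and> (S = N \<longrightarrow> nu = lam)"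
    by blast
  from bchoice[OF this] obtain sh where "\<forall>S\<in>Pow N. sh S \<in> partitions \<and> length (sh S) + card S = sum_list lam
      \<and> sum_list (sh S) = sum_list lam \<and> (\<forall>\<alpha>. of_nat (?K S \<alpha>) = psum (sh S) \<alpha>) \<and> (S = N \<longrightarrow> sh S = lam)"
    ..
  then have sh: "S \<subseteq> N \<Longrightarrow> sh S \<in> partitions \<and> length (sh S) + card S = sum_list lam
      \<and> sum_list (sh S) = sum_list lam \<and> (\<forall>\<alpha>. of_nat (?K S \<alpha>) = psum (sh S) \<alpha>) \<and> (S = N \<longrightarrow> sh S = lam)" for S
    by simp
  show ?thesis
  proof (rule psum_expansionI)
    show "finite N" "card N + length lam = sum_list lam" by fact+
    show "sh S \<in> partitions \<and> length (sh S) + card S = sum_list lam \<and> sum_list (sh S) = sum_list lam"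
      if "S \<subseteq> N" for S
      using sh[OF that] by blast
    show "sh N = lam" using sh[of N] by blast
    show "chrom ?V ?E (\<lambda>_. 1) \<alpha> = (\<Sum>S\<in>Pow N. (-1) ^ card S * psum (sh S) \<alpha>)" for \<alpha>
    proof -
      have "chrom ?V ?E (\<lambda>_. 1) \<alpha> = (\<Sum>S\<in>Pow N. (-1) ^ card S * of_nat (?K S \<alpha>))"
        by (rule chrom_rooted_forest_subsets[OF F]) simp
      also have "\<dots> = (\<Sum>S\<in>Pow N. (-1) ^ card S * psum (sh S) \<alpha>)"
      proof (rule sum.cong[OF refl])
        fix S assume "S \<in> Pow N"
        then have "of_nat (?K S \<alpha>) = psum (sh S) \<alpha>" using sh[of S] by blast
        then show "(-1) ^ card S * of_nat (?K S \<alpha>) = (-1) ^ card S * psum (sh S) \<alpha>"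
          by (simp only:)
      qed
      finally show ?thesis .
    qed
  qed
qed

section \<open>Bases of the symmetric functions\<close>

text \<open>The coefficient of a symmetric series at this exponent vector is its coefficient of the
  monomial symmetric function m_mu.\<close>

definition hat :: "nat list \<Rightarrow> nat \<Rightarrow> nat" where
  "hat mu i = (if i < length mu then mu ! i else 0)"

lemma hat_support:
  assumes "mu \<in> partitions"
  shows "{i. hat mu i \<noteq> 0} = {..<length mu}"
  using assms by (force simp: hat_def partitions_def in_set_conv_nth)

lemma sum_hat:
  assumes "mu \<in> partitions"
  shows "sum (hat mu) {i. hat mu i \<noteq> 0} = sum_list mu"
  unfolding hat_support[OF assms] by (simp add: hat_def sum_list_sum_nth atLeast0LessThan)

lemma partition_nth_pos:
  assumes "lam \<in> partitions" "i < length lam"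
  shows "lam ! i \<ge> 1"
  using assms by (metis One_nat_def Suc_leI mem_Collect_eq neq0_conv nth_mem partitions_def)

lemma partition_eqI:
  assumes "lam \<in> partitions" "mu \<in> partitions" "mset lam = mset mu"
  shows "lam = mu"
proof -
  have "sorted (rev lam)" "sorted (rev mu)"
    using assms(1,2) by (simp_all add: partitions_def sorted_wrt_rev)
  moreover have "mset (rev lam) = mset (rev mu)" using assms(3) by simp
  ultimately have "rev lam = rev mu"
    by (metis properties_for_sort)
  then show ?thesis by simp
qed

lemma psum_hat_sum_list:
  assumes "lam \<in> partitions" "mu \<in> partitions" "psum lam (hat mu) \<noteq> 0"
  shows "sum_list mu = sum_list lam"
proof -
  have "sum (hat mu) {i. hat mu i \<noteq> 0} = (\<Sum>i<length lam. lam ! i)"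
    using assms(3) partition_nth_pos[OF assms(1)] unfolding psum_def
    by (intro chrom_nonzeroD(2)) auto
  then show ?thesis
    unfolding sum_hat[OF assms(2)] by (simp add: sum_list_sum_nth atLeast0LessThan)
qed

text \<open>A contributing colouring maps the parts of \<open>lam\<close> onto the positions of
  \<open>mu\<close>, which forces \<open>length mu \<le> length lam\<close>. At equal length it is a
  bijection matching equal parts, so the multisets of parts agree.\<close>

lemma psum_hat_triangular:
  assumes lam: "lam \<in> partitions" and mu: "mu \<in> partitions"
    and nz: "psum lam (hat mu) \<noteq> 0" and len: "length lam \<le> length mu"
  shows "mu = lam"
proof -
  let ?V = "{..<length lam}"
  have "contents ?V (\<lambda>i. lam ! i) (hat mu) \<noteq> {}"
    using nz by (auto simp: psum_def discrete_contents)
  then obtain \<kappa> where k: "\<kappa> \<in> contents ?V (\<lambda>i. lam ! i) (hat mu)" by blast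
  have img: "\<kappa> ` ?V = {..<length mu}"
    using contents_image[OF _ _ k] partition_nth_pos[OF lam] hat_support[OF mu] by simp
  have "length mu \<le> length lam"
    using card_image_le[of ?V \<kappa>] img by simp
  then have eq: "length mu = length lam" using len by simp
  then have inj: "inj_on \<kappa> ?V"
    using img by (intro eq_card_imp_inj_on) auto
  have nth: "mu ! (\<kappa> i) = lam ! i" if i: "i \<in> ?V" for i
  proof -
    have "{v\<in>?V. \<kappa> v = \<kappa> i} = {i}"
      using inj i by (auto dest: inj_onD)
    moreover have "(\<Sum>v\<in>{v\<in>?V. \<kappa> v = \<kappa> i}. lam ! v) = hat mu (\<kappa> i)"
      using k by (simp add: contents_def)
    ultimately have "lam ! i = hat mu (\<kappa> i)" by simp
    moreover have "\<kappa> i < length mu" using img i by blast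
    ultimately show ?thesis by (simp add: hat_def)
  qed
  have ms: "mset xs = image_mset ((!) xs) (mset_set {..<length xs})" for xs :: "nat list"
    by (metis map_nth mset_map mset_upt atLeast0LessThan)
  have "mset lam = image_mset (\<lambda>i. mu ! (\<kappa> i)) (mset_set ?V)"
    unfolding ms[of lam] using nth by (intro image_mset_cong) auto
  also have "\<dots> = image_mset ((!) mu) (image_mset \<kappa> (mset_set ?V))"
    by (simp add: image_mset.compositionality comp_def)
  also have "\<dots> = mset mu"
    unfolding image_mset_mset_set[OF inj] img ms[of mu] ..
  finally show ?thesis using partition_eqI[OF lam mu] by simp
qed

lemma psum_hat_diagonal:
  assumes lam: "lam \<in> partitions"
  shows "psum lam (hat lam) \<noteq> 0"
proof -
  let ?V = "{..<length lam}"
  let ?k = "restrict (\<lambda>i. i) ?V"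
  have "(\<Sum>v\<in>{v\<in>?V. ?k v = i}. lam ! v) = hat lam i" for i
  proof -
    have "{v\<in>?V. ?k v = i} = (if i < length lam then {i} else {})" by auto
    then show ?thesis by (simp add: hat_def)
  qed
  then have "?k \<in> contents ?V (\<lambda>i. lam ! i) (hat lam)"
    unfolding contents_def by simp
  moreover have "finite (contents ?V (\<lambda>i. lam ! i) (hat lam))"
    using partition_nth_pos[OF lam] by (intro finite_contents) auto
  ultimately show ?thesis
    by (auto simp: psum_def discrete_contents)
qed

section \<open>Unique solvability of triangular linear systems\<close>

text \<open>Invertibility of \<open>M\<close> on \<open>I\<close>, acting on row vectors; values
  outside \<open>I\<close> are fixed at 0 so that the solution is unique as a function.\<close>

definition solvable :: "'a set \<Rightarrow> ('a \<Rightarrow> 'a \<Rightarrow> rat) \<Rightarrow> bool" where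
  "solvable I M \<longleftrightarrow> (\<forall>b. \<exists>!a. (\<forall>x. x \<notin> I \<longrightarrow> a x = 0) \<and> (\<forall>y\<in>I. (\<Sum>x\<in>I. a x * M x y) = b y))"

text \<open>Indices are added by increasing rank. The column of the newest index \<open>x\<close>
  vanishes off the diagonal, which forces \<open>a x\<close>; the other unknowns then solve a system
  over the earlier indices. Integer ranks allow an order by length to be reversed.\<close>

lemma solvable_triangular:
  fixes r :: "'a \<Rightarrow> int"
  assumes "finite I" and "\<And>x. x \<in> I \<Longrightarrow> M x x \<noteq> 0"
    and "\<And>x y. \<lbrakk>x \<in> I; y \<in> I; x \<noteq> y; r x \<le> r y\<rbrakk> \<Longrightarrow> M x y = 0"
  shows "solvable I M"
  using assms
proof (induction I rule: finite_ranking_induct[where f = r])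
  case empty
  show ?case unfolding solvable_def by (auto intro!: ex1I[of _ "\<lambda>_. 0"])
next
  case (insert x I)
  show ?case
  proof (cases "x \<in> I")
    case True
    then show ?thesis using insert by (simp add: insert_absorb)
  next
    case x: False
    have solv: "solvable I M" using insert.IH insert.prems by auto
    have nz: "M x x \<noteq> 0" using insert.prems(1) by simp
    have col: "M z x = 0" if "z \<in> I" for z
      using insert.prems(2)[of z x] insert.hyps(2)[OF that] that x by auto
    show ?thesis
      unfolding solvable_def
    proof
      fix b :: "'a \<Rightarrow> rat"
      \<comment> \<open>The right-hand side left for \<open>I\<close> once the forced value
        \<open>b x / M x x\<close> of \<open>a x\<close> is substituted.\<close>
      define b' where "b' y = b y - b x / M x x * M x y" for y
      let ?sol = "\<lambda>a. (\<forall>z. z \<notin> I \<longrightarrow> a z = 0) \<and> (\<forall>y\<in>I. (\<Sum>z\<in>I. a z * M z y) = b' y)"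
      let ?sol' = "\<lambda>a. (\<forall>z. z \<notin> insert x I \<longrightarrow> a z = 0)
        \<and> (\<forall>y\<in>insert x I. (\<Sum>z\<in>insert x I. a z * M z y) = b y)"
      have ex1: "\<exists>!a. ?sol a" using solv by (simp add: solvable_def)
      have S: "(\<Sum>z\<in>insert x I. a z * M z y) = a x * M x y + (\<Sum>z\<in>I. a z * M z y)" for a y
        using insert.hyps(1) x by simp
      have Sx: "(\<Sum>z\<in>I. a z * M z x) = 0" for a
        using col by simp
      have ax: "a x = b x / M x x" if "?sol' a" for a
      proof -
        have "a x * M x x = b x" using that S[of a x] Sx[of a] by auto
        then show ?thesis using nz by (simp add: field_simps)
      qed
      have upd: "(\<Sum>z\<in>I. (a(x := t)) z * M z y) = (\<Sum>z\<in>I. a z * M z y)" for a t y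
        using x by (intro sum.cong) auto
      have down: "?sol (a(x := 0))" if "?sol' a" for a
      proof (intro conjI ballI)
        show "\<forall>z. z \<notin> I \<longrightarrow> (a(x := 0)) z = 0" using that by auto
        fix y assume "y \<in> I"
        then have "a x * M x y + (\<Sum>z\<in>I. a z * M z y) = b y"
          using that S[of a y] by auto
        then show "(\<Sum>z\<in>I. (a(x := 0)) z * M z y) = b' y"
          unfolding upd using ax[OF that] by (simp add: b'_def)
      qed
      have up: "?sol' (a(x := b x / M x x))" if "?sol a" for a
      proof (intro conjI ballI)
        show "\<forall>z. z \<notin> insert x I \<longrightarrow> (a(x := b x / M x x)) z = 0" using that by auto
        fix y assume "y \<in> insert x I"
        then show "(\<Sum>z\<in>insert x I. (a(x := b x / M x x)) z * M z y) = b y"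
          unfolding S upd using that Sx[of a] nz by (auto simp: b'_def)
      qed
      show "\<exists>!a. ?sol' a"
      proof (rule ex_ex1I)
        show "\<exists>a. ?sol' a" using ex1 up by blast
        fix a1 a2 assume a: "?sol' a1" "?sol' a2"
        have "a1(x := 0) = a2(x := 0)" using ex1 down[OF a(1)] down[OF a(2)] by blast
        moreover have "a1 x = a2 x" using ax[OF a(1)] ax[OF a(2)] by simp
        ultimately show "a1 = a2" by (metis fun_upd_triv fun_upd_upd)
      qed
    qed
  qed
qed

text \<open>Solve first with \<open>P\<close>, then take that solution as the right-hand side for
  \<open>C\<close>.\<close>

lemma solvable_product:
  assumes "finite I" and C: "solvable I C" and P: "solvable I P"
    and M: "\<And>x y. \<lbrakk>x \<in> I; y \<in> I\<rbrakk> \<Longrightarrow> M x y = (\<Sum>z\<in>I. C x z * P z y)"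
  shows "solvable I M"
  unfolding solvable_def
proof
  fix b :: "'a \<Rightarrow> rat"
  have MP: "(\<Sum>x\<in>I. a x * M x y) = (\<Sum>z\<in>I. (\<Sum>x\<in>I. a x * C x z) * P z y)" if "y \<in> I" for a y
  proof -
    have "(\<Sum>x\<in>I. a x * M x y) = (\<Sum>x\<in>I. \<Sum>z\<in>I. a x * C x z * P z y)"
      using M[OF _ that] by (simp add: sum_distrib_left mult.assoc)
    also have "\<dots> = (\<Sum>z\<in>I. \<Sum>x\<in>I. a x * C x z * P z y)" by (rule sum.swap)
    finally show ?thesis by (simp add: sum_distrib_right)
  qed
  let ?S = "\<lambda>M b a. (\<forall>x. x \<notin> I \<longrightarrow> a x = 0) \<and> (\<forall>y\<in>I. (\<Sum>x\<in>I. a x * M x y) = b y)"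
  have "\<exists>!g. ?S P b g" using P unfolding solvable_def by (rule spec)
  then obtain g where g: "?S P b g" and g1: "\<And>h. ?S P b h \<Longrightarrow> h = g"
    by (rule ex1E) blast
  have "\<exists>!a. ?S C g a" using C unfolding solvable_def by (rule spec)
  then obtain a where a: "?S C g a" and a1: "\<And>h. ?S C g h \<Longrightarrow> h = a"
    by (rule ex1E) blast
  show "\<exists>!a. ?S M b a"
  proof (rule ex1I[of _ a])
    show "?S M b a" using a g MP by simp
    fix h assume h: "?S M b h"
    \<comment> \<open>Any solution pushed through \<open>C\<close> solves the system for
      \<open>P\<close>; it is set to 0 outside \<open>I\<close> to meet the support
      condition.\<close>
    define k where "k z = (if z \<in> I then \<Sum>x\<in>I. h x * C x z else 0)" for z
    have "?S P b k"
      using h MP by (simp add: k_def)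
    then have kg: "k = g" by (rule g1)
    have "(\<Sum>x\<in>I. h x * C x z) = g z" if "z \<in> I" for z
      using fun_cong[OF kg, of z] that by (simp add: k_def)
    then have "?S C g h" using h by simp
    then show "h = a" by (rule a1)
  qed
qed

text \<open>Both complements are infinite sets of naturals, so a bijection between them completes
  the finite enumeration. The extension is wanted because \<open>Sym\<close> speaks of bijections of
  all variables.\<close>

lemma bij_extending_enumeration:
  assumes "distinct (xs :: nat list)"
  shows "\<exists>\<sigma>. bij \<sigma> \<and> (\<forall>i<length xs. \<sigma> i = xs ! i)"
proof -
  let ?A = "- {..<length xs}" and ?B = "- set xs"
  have inf: "infinite ?A" "infinite ?B"
    by (simp_all add: finite_compl del: Compl_lessThan)
  have f: "bij_betw (to_nat_on ?A) ?A UNIV" and g: "bij_betw (to_nat_on ?B) ?B UNIV"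
    using inf by (auto intro: to_nat_on_infinite)
  obtain h where h: "bij_betw h ?A ?B"
    using bij_betw_trans[OF f bij_betw_inv_into[OF g]] by blast
  have e: "bij_betw ((!) xs) {..<length xs} (set xs)"
    using assms by (rule bij_betw_nth) auto
  have "bij_betw (\<lambda>i. if i \<in> {..<length xs} then xs ! i else h i) ({..<length xs} \<union> ?A) (set xs \<union> ?B)"
    by (rule bij_betw_disjoint_Un[OF e h]) auto
  then have "bij (\<lambda>i. if i \<in> {..<length xs} then xs ! i else h i)"
    by (simp only: Compl_partition)
  then show ?thesis by (intro exI conjI) (assumption, simp)
qed

text \<open>A permutation of the variables sorts any finitely supported exponent vector into the
  shape \<open>hat mu\<close>; at all other vectors both series vanish.\<close>

lemma Sym_eqI:
  assumes f: "f \<in> Sym" and g: "g \<in> Sym" and eq: "\<And>mu. mu \<in> partitions \<Longrightarrow> f (hat mu) = g (hat mu)"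
  shows "f = g"
proof
  fix \<alpha>
  show "f \<alpha> = g \<alpha>"
  proof (cases "finite {i. \<alpha> i \<noteq> 0}")
    case False
    then show ?thesis using f g by (simp add: Sym_def)
  next
    case True
    then obtain ys where ys: "set ys = {i. \<alpha> i \<noteq> 0}" "distinct ys"
      using finite_distinct_list by blast
    define xs where "xs = rev (sort_key \<alpha> ys)"
    have xs: "set xs = {i. \<alpha> i \<noteq> 0}" "distinct xs"
      using ys by (simp_all add: xs_def)
    have "sorted_wrt (\<ge>) (map \<alpha> xs)"
      unfolding xs_def rev_map[symmetric] by (simp add: sorted_wrt_rev)
    moreover have "0 \<notin> set (map \<alpha> xs)"
      using xs by auto
    ultimately have part: "map \<alpha> xs \<in> partitions"
      by (simp add: partitions_def)
    obtain \<sigma> where \<sigma>: "bij \<sigma>" "\<forall>i<length xs. \<sigma> i = xs ! i"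
      using bij_extending_enumeration[OF xs(2)] by blast
    have "\<alpha> \<circ> \<sigma> = hat (map \<alpha> xs)"
    proof
      fix i
      show "(\<alpha> \<circ> \<sigma>) i = hat (map \<alpha> xs) i"
      proof (cases "i < length xs")
        case True
        then show ?thesis using \<sigma>(2) by (simp add: hat_def)
      next
        case False
        have "\<sigma> i \<notin> set xs"
        proof
          assume "\<sigma> i \<in> set xs"
          then obtain j where "j < length xs" "xs ! j = \<sigma> i" by (metis in_set_conv_nth)
          then have "\<sigma> j = \<sigma> i" using \<sigma>(2) by simp
          then have "j = i" using \<sigma>(1) by (metis bij_is_inj injD)
          then show False using False \<open>j < length xs\<close> by simp
        qed
        then show ?thesis using False xs(1) by (simp add: hat_def)
      qed
    qed
    moreover have "f (\<alpha> \<circ> \<sigma>) = f \<alpha>" "g (\<alpha> \<circ> \<sigma>) = g \<alpha>"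
      using f g \<sigma>(1) by (simp_all add: Sym_def)
    ultimately show ?thesis using eq[OF part] by simp
  qed
qed

lemma Sym_lincomb:
  assumes a: "coeff_family a" and B: "\<And>lam. lam \<in> partitions \<Longrightarrow> B lam \<in> Sym"
  shows "lincomb a B \<in> Sym"
proof -
  let ?A = "{lam. a lam \<noteq> 0}"
  have Sy: "B lam \<in> Sym" if "lam \<in> ?A" for lam
    using a B that unfolding coeff_family_def by blast
  have finA: "finite ?A" using a by (simp add: coeff_family_def)
  have "\<forall>lam. \<exists>N. lam \<in> ?A \<longrightarrow> (\<forall>\<alpha>. sum \<alpha> {i. \<alpha> i \<noteq> 0} > N \<longrightarrow> B lam \<alpha> = 0)"
    using Sy unfolding Sym_def by blast
  then obtain n where n: "\<And>lam \<alpha>. \<lbrakk>lam \<in> ?A; sum \<alpha> {i. \<alpha> i \<noteq> 0} > n lam\<rbrakk> \<Longrightarrow> B lam \<alpha> = 0"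
    by metis
  \<comment> \<open>The sum of the individual degree bounds dominates each of them.\<close>
  have "lincomb a B \<alpha> = 0" if big: "sum \<alpha> {i. \<alpha> i \<noteq> 0} > sum n ?A" for \<alpha>
  proof -
    have "B lam \<alpha> = 0" if "lam \<in> ?A" for lam
      using n[OF that, of \<alpha>] member_le_sum[OF that, of n] finA big by linarith
    then show ?thesis by (simp add: lincomb_def)
  qed
  moreover have "lincomb a B \<alpha> = 0" if "infinite {i. \<alpha> i \<noteq> 0}" for \<alpha>
    using Sy that by (simp add: lincomb_def Sym_def)
  moreover have "lincomb a B (\<alpha> \<circ> \<sigma>) = lincomb a B \<alpha>" if "bij \<sigma>" for \<alpha> \<sigma>
    using Sy that by (simp add: lincomb_def Sym_def)
  ultimately show ?thesis unfolding Sym_def by blast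
qed

lemma length_le_sum_list:
  assumes "lam \<in> partitions"
  shows "length lam \<le> sum_list lam"
proof -
  have "length lam = (\<Sum>i<length lam. 1)" by simp
  also have "\<dots> \<le> (\<Sum>i<length lam. lam ! i)"
    using partition_nth_pos[OF assms] by (intro sum_mono) simp
  also have "\<dots> = sum_list lam" by (simp add: sum_list_sum_nth atLeast0LessThan)
  finally show ?thesis .
qed

lemma finite_partitions_bounded: "finite {lam \<in> partitions. sum_list lam \<le> N}"
proof (rule finite_subset)
  show "finite {lam. set lam \<subseteq> {..N} \<and> length lam \<le> N}"
    by (rule finite_lists_length_le) simp
  show "{lam \<in> partitions. sum_list lam \<le> N} \<subseteq> {lam. set lam \<subseteq> {..N} \<and> length lam \<le> N}"
  proof safe
    fix lam x assume l: "lam \<in> partitions" "sum_list lam \<le> N"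
    show "x \<le> N" if "x \<in> set lam"
      using member_le_sum_list[OF that] l by simp
    show "length lam \<le> N" using length_le_sum_list[OF l(1)] l(2) by simp
  qed
qed

text \<open>On partitions of size at most N, the matrix of coefficients of \<open>X lam\<close> at
  \<open>hat mu\<close> is a product of two matrices, triangular in opposite orders. Degrees are
  bounded and supports finite, so such a truncation decides existence and uniqueness.\<close>

lemma is_basis_psum_expansion:
  assumes Sy: "\<And>lam. lam \<in> partitions \<Longrightarrow> X lam \<in> Sym"
    and ex: "\<And>lam. lam \<in> partitions \<Longrightarrow> \<exists>c. psum_expansion (X lam) lam c"
  shows "is_basis X"
proof -
  obtain C where C: "\<And>lam. lam \<in> partitions \<Longrightarrow> psum_expansion (X lam) lam (C lam)"
    using ex by metis
  define I where "I N = {lam \<in> partitions. sum_list lam \<le> N}" for N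
  have finI: "finite (I N)" for N unfolding I_def by (rule finite_partitions_bounded)
  have IP: "I N \<subseteq> partitions" for N by (auto simp: I_def)
  have Xsum: "X lam \<alpha> = (\<Sum>nu\<in>I N. C lam nu * psum nu \<alpha>)" if "lam \<in> I N" for lam \<alpha> N
  proof -
    have "psum_expansion (X lam) lam (C lam)" using C IP that by blast
    then have "X lam = lincomb (C lam) psum" "{nu. C lam nu \<noteq> 0} \<subseteq> partitions"
        "\<And>nu. C lam nu \<noteq> 0 \<Longrightarrow> sum_list nu = sum_list lam"
      unfolding psum_expansion_def coeff_family_def by blast+
    moreover from this that have "{nu. C lam nu \<noteq> 0} \<subseteq> I N"
      by (auto simp: I_def)
    moreover have "(\<Sum>nu\<in>{nu. C lam nu \<noteq> 0}. C lam nu * psum nu \<alpha>) = (\<Sum>nu\<in>I N. C lam nu * psum nu \<alpha>)"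
      if "{nu. C lam nu \<noteq> 0} \<subseteq> I N"
      using that finI by (intro sum.mono_neutral_left) auto
    ultimately show ?thesis by (simp add: lincomb_def)
  qed
  have solv: "solvable (I N) (\<lambda>lam mu. X lam (hat mu))" for N
  proof (rule solvable_product)
    show "finite (I N)" by (rule finI)
    \<comment> \<open>Besides \<open>lam\<close> itself only longer partitions occur in the
      expansion of \<open>X lam\<close>, so the rank is minus the length.\<close>
    show "solvable (I N) C"
    proof (rule solvable_triangular[where r = "\<lambda>lam. - int (length lam)"])
      show "finite (I N)" by (rule finI)
      show "C lam lam \<noteq> 0" if "lam \<in> I N" for lam
        using C[of lam] that IP by (auto simp: psum_expansion_def)
      show "C lam nu = 0" if "lam \<in> I N" "lam \<noteq> nu" "- int (length lam) \<le> - int (length nu)" for lam nu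
        using C[of lam] that IP by (auto simp: psum_expansion_def)
    qed
    \<comment> \<open>Besides \<open>lam\<close> itself only shorter \<open>mu\<close> occur in the
      power sum, so the rank is the length.\<close>
    show "solvable (I N) (\<lambda>lam mu. psum lam (hat mu))"
    proof (rule solvable_triangular[where r = "\<lambda>lam. int (length lam)"])
      show "finite (I N)" by (rule finI)
      show "psum lam (hat lam) \<noteq> 0" if "lam \<in> I N" for lam
        using psum_hat_diagonal that IP by blast
      show "psum lam (hat mu) = 0"
        if "lam \<in> I N" "mu \<in> I N" "lam \<noteq> mu" "int (length lam) \<le> int (length mu)" for lam mu
        using psum_hat_triangular[of lam mu] that IP by auto
    qed
    show "X lam (hat mu) = (\<Sum>nu\<in>I N. C lam nu * psum nu (hat mu))" if "lam \<in> I N" for lam mu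
      using Xsum[OF that] .
  qed
  have lin: "lincomb a X \<alpha> = (\<Sum>lam\<in>I N. a lam * X lam \<alpha>)" if "{lam. a lam \<noteq> 0} \<subseteq> I N" for a N \<alpha>
    unfolding lincomb_def using that finI by (intro sum.mono_neutral_left) auto
  \<comment> \<open>No coefficient appears in degree above N, so a solution on \<open>I N\<close> is
    correct at all partitions.\<close>
  have Xdeg: "X lam (hat mu) = 0" if "lam \<in> I N" "mu \<in> partitions" "mu \<notin> I N" for lam mu N
  proof -
    have "psum nu (hat mu) = 0" if "nu \<in> I N" for nu
      using psum_hat_sum_list[of nu mu] that \<open>mu \<in> partitions\<close> \<open>mu \<notin> I N\<close> by (auto simp: I_def)
    then show ?thesis using Xsum[OF that(1)] by simp
  qed
  have "\<exists>!a. coeff_family a \<and> f = lincomb a X" if f: "f \<in> Sym" for f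
  proof (rule ex_ex1I)
    obtain N where N: "\<And>\<alpha>. sum \<alpha> {i. \<alpha> i \<noteq> 0} > N \<Longrightarrow> f \<alpha> = 0"
      using f unfolding Sym_def by blast
    obtain a where a0: "\<forall>lam. lam \<notin> I N \<longrightarrow> a lam = 0"
      and a: "\<forall>mu\<in>I N. (\<Sum>lam\<in>I N. a lam * X lam (hat mu)) = f (hat mu)"
      using solv[of N, unfolded solvable_def, rule_format, of "\<lambda>mu. f (hat mu)"] by blast
    have sub: "{lam. a lam \<noteq> 0} \<subseteq> I N" using a0 by blast
    then have cf: "coeff_family a"
      using finI IP unfolding coeff_family_def by (meson finite_subset order_trans)
    have "f = lincomb a X"
    proof (rule Sym_eqI[OF f Sym_lincomb[OF cf Sy]])
      fix mu assume mu: "mu \<in> partitions"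
      show "f (hat mu) = lincomb a X (hat mu)"
      proof (cases "mu \<in> I N")
        case True
        then show ?thesis using a lin[OF sub] by simp
      next
        case False
        then have "f (hat mu) = 0"
          using N[of "hat mu"] mu sum_hat[OF mu] by (simp add: I_def)
        then show ?thesis using lin[OF sub] Xdeg[OF _ mu False] by simp
      qed
    qed
    then show "\<exists>a. coeff_family a \<and> f = lincomb a X" using cf by blast
  next
    fix a b assume a: "coeff_family a \<and> f = lincomb a X" and b: "coeff_family b \<and> f = lincomb b X"
    let ?A = "{lam. a lam \<noteq> 0} \<union> {lam. b lam \<noteq> 0}"
    have fin: "finite ?A" and sub: "?A \<subseteq> partitions"
      using a b by (auto simp: coeff_family_def)
    \<comment> \<open>A bound on the sizes in both supports, so that both families solve the same
      finite system.\<close>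
    define N where "N = sum sum_list ?A"
    have AI: "?A \<subseteq> I N"
      using member_le_sum[of _ ?A sum_list] fin sub unfolding I_def N_def by blast
    have "\<forall>mu\<in>I N. (\<Sum>lam\<in>I N. a lam * X lam (hat mu)) = f (hat mu)"
      using a lin[of a N] AI by auto
    moreover have "\<forall>mu\<in>I N. (\<Sum>lam\<in>I N. b lam * X lam (hat mu)) = f (hat mu)"
      using b lin[of b N] AI by auto
    moreover have "\<forall>lam. lam \<notin> I N \<longrightarrow> a lam = 0" "\<forall>lam. lam \<notin> I N \<longrightarrow> b lam = 0"
      using AI by blast+
    ultimately show "a = b"
      using solv[of N, unfolded solvable_def, rule_format, of "\<lambda>mu. f (hat mu)"] by blast
  qed
  then show ?thesis using Sy unfolding is_basis_def by blast
qed

section \<open>Specialisation at finitely many equal variables\<close>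

definition exponents :: "nat \<Rightarrow> nat \<Rightarrow> (nat \<Rightarrow> nat) set" where
  "exponents m M = {\<alpha>. \<forall>i. (i \<in> {..<m} \<longrightarrow> \<alpha> i \<in> {..M}) \<and> (i \<notin> {..<m} \<longrightarrow> \<alpha> i = 0)}"

text \<open>The specialisation \<open>x\<^sub>0 = \<dots> = x\<^bsub>m-1\<^esub> = y\<close>, \<open>x\<^sub>i = 0\<close> for \<open>i \<ge> m\<close>, applied to the part
  of \<open>f\<close> with all exponents at most \<open>M\<close>.\<close>

definition spec_eval :: "nat \<Rightarrow> nat \<Rightarrow> rat \<Rightarrow> series \<Rightarrow> rat" where
  "spec_eval m M y f = (\<Sum>\<alpha>\<in>exponents m M. f \<alpha> * y ^ (\<Sum>i<m. \<alpha> i))"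

lemma finite_exponents: "finite (exponents m M)"
  unfolding exponents_def by (rule finite_set_of_finite_funs) simp_all

lemma spec_eval_lincomb:
  "spec_eval m M y (lincomb a B) = (\<Sum>lam\<in>{lam. a lam \<noteq> 0}. a lam * spec_eval m M y (B lam))"
proof -
  have "spec_eval m M y (lincomb a B)
      = (\<Sum>\<alpha>\<in>exponents m M. \<Sum>lam\<in>{lam. a lam \<noteq> 0}. a lam * (B lam \<alpha> * y ^ (\<Sum>i<m. \<alpha> i)))"
    by (simp add: spec_eval_def lincomb_def sum_distrib_right mult.assoc)
  also have "\<dots> = (\<Sum>lam\<in>{lam. a lam \<noteq> 0}. \<Sum>\<alpha>\<in>exponents m M. a lam * (B lam \<alpha> * y ^ (\<Sum>i<m. \<alpha> i)))"
    by (rule sum.swap)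
  finally show ?thesis by (simp add: spec_eval_def sum_distrib_left)
qed

text \<open>Group the \<open>m ^ card W\<close> colourings with \<open>m\<close> colours by content;
  each contributes \<open>y\<close> to the power of the total weight. The bound on \<open>M\<close>
  ensures that no content falls outside the box.\<close>

lemma spec_eval_discrete:
  assumes fin: "finite W" and w: "\<forall>v\<in>W. w v \<ge> 1" and M: "sum w W \<le> M"
  shows "spec_eval m M y (discrete W w) = of_nat m ^ card W * y ^ sum w W"
proof -
  let ?K = "W \<rightarrow>\<^sub>E {..<m}"
  define g where "g \<kappa> i = (\<Sum>v\<in>{v\<in>W. \<kappa> v = i}. w v)" for \<kappa> and i :: nat
  have finK: "finite ?K" using fin by (intro finite_PiE) auto
  have gE: "g ` ?K \<subseteq> exponents m M"
  proof (rule image_subsetI)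
    fix \<kappa> assume k: "\<kappa> \<in> ?K"
    have "g \<kappa> i \<le> M" for i
    proof -
      have "g \<kappa> i \<le> sum w W" unfolding g_def using fin by (intro sum_mono2) auto
      then show ?thesis using M by simp
    qed
    moreover have "g \<kappa> i = 0" if "i \<notin> {..<m}" for i
    proof -
      have "{v\<in>W. \<kappa> v = i} = {}" using k that by auto
      then show ?thesis by (simp only: g_def sum.empty)
    qed
    ultimately show "g \<kappa> \<in> exponents m M" by (simp add: exponents_def)
  qed
  have cont: "contents W w \<alpha> = {\<kappa>\<in>?K. g \<kappa> = \<alpha>}" if a: "\<alpha> \<in> exponents m M" for \<alpha>
  proof (intro equalityI subsetI)
    fix \<kappa> assume k: "\<kappa> \<in> contents W w \<alpha>"
    have "\<kappa> ` W \<subseteq> {..<m}"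
      unfolding contents_image[OF fin w k] using a by (auto simp: exponents_def) (metis not_gr_zero)
    then show "\<kappa> \<in> {\<kappa>\<in>?K. g \<kappa> = \<alpha>}"
      using k by (auto simp: contents_def PiE_iff g_def fun_eq_iff)
  next
    fix \<kappa> assume "\<kappa> \<in> {\<kappa>\<in>?K. g \<kappa> = \<alpha>}"
    then show "\<kappa> \<in> contents W w \<alpha>"
      by (auto simp: contents_def PiE_iff g_def)
  qed
  have deg: "(\<Sum>i<m. g \<kappa> i) = sum w W" if "\<kappa> \<in> ?K" for \<kappa>
    unfolding g_def by (rule sum.group) (use that fin in auto)
  have "spec_eval m M y (discrete W w) = (\<Sum>\<alpha>\<in>exponents m M. \<Sum>\<kappa>\<in>{\<kappa>\<in>?K. g \<kappa> = \<alpha>}. y ^ sum w W)"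
    unfolding spec_eval_def
  proof (rule sum.cong[OF refl])
    fix \<alpha> assume a: "\<alpha> \<in> exponents m M"
    have "discrete W w \<alpha> * y ^ (\<Sum>i<m. \<alpha> i) = (\<Sum>\<kappa>\<in>{\<kappa>\<in>?K. g \<kappa> = \<alpha>}. y ^ (\<Sum>i<m. \<alpha> i))"
      by (simp add: discrete_contents cont[OF a])
    also have "\<dots> = (\<Sum>\<kappa>\<in>{\<kappa>\<in>?K. g \<kappa> = \<alpha>}. y ^ sum w W)"
      using deg by (intro sum.cong) auto
    finally show "discrete W w \<alpha> * y ^ (\<Sum>i<m. \<alpha> i) = (\<Sum>\<kappa>\<in>{\<kappa>\<in>?K. g \<kappa> = \<alpha>}. y ^ sum w W)" .
  qed
  also have "\<dots> = (\<Sum>\<kappa>\<in>?K. y ^ sum w W)"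
    by (rule sum.group[OF finK finite_exponents gE])
  also have "\<dots> = of_nat m ^ card W * y ^ sum w W"
    using fin by (simp add: card_PiE)
  finally show ?thesis .
qed

lemma spec_eval_psum:
  assumes "lam \<in> partitions" "sum_list lam \<le> M"
  shows "spec_eval m M y (psum lam) = of_nat m ^ length lam * y ^ sum_list lam"
proof -
  have s: "(\<Sum>i<length lam. lam ! i) = sum_list lam"
    by (simp add: sum_list_sum_nth atLeast0LessThan)
  show ?thesis
    using spec_eval_discrete[of "{..<length lam}" "\<lambda>i. lam ! i" M m y] partition_nth_pos[OF assms(1)]
      assms(2) unfolding psum_def s by simp
qed

text \<open>Homogeneity contributes y^n with y = 1/(m-1), and n-k of these factors cancel
  (m-1)^(n-k). What is left depends on the number k of components alone.\<close>

lemma spec_eval_psum_expansion: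
  assumes "psum_expansion f lam c" "lam \<in> partitions" "sum_list lam \<le> M" "m \<ge> 2"
  shows "spec_eval m M (1 / (of_nat m - 1)) f = (of_nat m / (of_nat m - 1)) ^ length lam"
proof -
  let ?x = "of_nat m :: rat" and ?n = "sum_list lam" and ?k = "length lam"
  let ?y = "1 / (?x - 1)"
  have y: "(?x - 1) * ?y = 1" using assms(4) by simp
  have f: "f = lincomb c psum" and c: "coeff_family c" "\<And>nu. c nu \<noteq> 0 \<Longrightarrow> sum_list nu = ?n"
    and tot: "(\<Sum>nu\<in>{nu. c nu \<noteq> 0}. c nu * ?x ^ length nu) = ?x ^ ?k * (?x - 1) ^ (?n - ?k)"
    using assms(1) unfolding psum_expansion_def by blast+
  have "spec_eval m M ?y f = (\<Sum>nu\<in>{nu. c nu \<noteq> 0}. c nu * ?x ^ length nu * ?y ^ ?n)"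
    unfolding f spec_eval_lincomb
  proof (rule sum.cong[OF refl])
    fix nu assume "nu \<in> {nu. c nu \<noteq> 0}"
    then have "nu \<in> partitions" "sum_list nu = ?n"
      using c by (auto simp: coeff_family_def)
    then show "c nu * spec_eval m M ?y (psum nu) = c nu * ?x ^ length nu * ?y ^ ?n"
      using spec_eval_psum[of nu M m ?y] assms(3) by simp
  qed
  \<comment> \<open>The split of n as k + (n-k) is exact because a partition has at most as many
    parts as its size.\<close>
  also have "\<dots> = ?x ^ ?k * (?x - 1) ^ (?n - ?k) * ?y ^ (?k + (?n - ?k))"
    using length_le_sum_list[OF assms(2)] by (simp flip: sum_distrib_right add: tot)
  also have "\<dots> = (?x * ?y) ^ ?k * ((?x - 1) * ?y) ^ (?n - ?k)"
    by (simp only: power_add power_mult_distrib mult_ac)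
  also have "\<dots> = (?x / (?x - 1)) ^ ?k"
    unfolding y by simp
  finally show ?thesis .
qed

section \<open>Values and coefficients of the length polynomial\<close>

lemma is_basis_bcoeff:
  assumes "is_basis B" "f \<in> Sym"
  shows "coeff_family (bcoeff B f)" "f = lincomb (bcoeff B f) B"
proof -
  have "\<exists>!a. coeff_family a \<and> f = lincomb a B" using assms by (simp add: is_basis_def)
  from theI'[OF this] show "coeff_family (bcoeff B f)" "f = lincomb (bcoeff B f) B"
    unfolding bcoeff_def by blast+
qed

text \<open>Each basis element specialises to a power of m/(m-1), so specialising \<open>f\<close>
  evaluates the polynomial. The cutoff has to cover the sizes of all partitions in the expansion,
  hence depends on the basis.\<close>

lemma poly_tau:
  assumes B: "is_basis B" "f \<in> Sym"
    and ex: "\<And>lam. lam \<in> partitions \<Longrightarrow> \<exists>c. psum_expansion (B lam) lam c"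
  shows "\<exists>M0. \<forall>M\<ge>M0. \<forall>m\<ge>2. poly (tau B f) (of_nat m / (of_nat m - 1))
    = spec_eval m M (1 / (of_nat m - 1)) f"
proof -
  let ?a = "bcoeff B f"
  let ?A = "{lam. ?a lam \<noteq> 0}"
  have f: "f = lincomb ?a B" and fin: "finite ?A" and sub: "?A \<subseteq> partitions"
    using is_basis_bcoeff[OF B] by (simp_all add: coeff_family_def)
  have "poly (tau B f) (of_nat m / (of_nat m - 1)) = spec_eval m M (1 / (of_nat m - 1)) f"
    if M: "M \<ge> sum sum_list ?A" and m: "m \<ge> 2" for m M
  proof -
    have "spec_eval m M (1 / (of_nat m - 1)) f
        = (\<Sum>lam\<in>?A. ?a lam * spec_eval m M (1 / (of_nat m - 1)) (B lam))"
      by (subst f) (rule spec_eval_lincomb)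
    also have "\<dots> = (\<Sum>lam\<in>?A. ?a lam * (of_nat m / (of_nat m - 1)) ^ length lam)"
    proof (rule sum.cong[OF refl])
      fix lam assume lam: "lam \<in> ?A"
      then have "lam \<in> partitions" using sub by blast
      moreover have "sum_list lam \<le> M"
        using member_le_sum[OF lam, of sum_list] fin M by simp
      ultimately show "?a lam * spec_eval m M (1 / (of_nat m - 1)) (B lam)
          = ?a lam * (of_nat m / (of_nat m - 1)) ^ length lam"
        using ex spec_eval_psum_expansion m by metis
    qed
    also have "\<dots> = poly (tau B f) (of_nat m / (of_nat m - 1))"
      by (simp add: tau_def poly_sum poly_monom)
    finally show ?thesis by simp
  qed
  then show ?thesis by blast
qed

text \<open>The specialisation of \<open>f\<close> mentions no basis, so both polynomials agree at
  m/(m-1) for all m \<ge> 2. These points are distinct, and a nonzero difference has only finitely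
  many roots.\<close>

lemma tau_unique:
  assumes B: "is_basis B" "\<And>lam. lam \<in> partitions \<Longrightarrow> \<exists>c. psum_expansion (B lam) lam c"
    and C: "is_basis C" "\<And>lam. lam \<in> partitions \<Longrightarrow> \<exists>c. psum_expansion (C lam) lam c"
    and f: "f \<in> Sym"
  shows "tau B f = tau C f"
proof (rule ccontr)
  assume "tau B f \<noteq> tau C f"
  then have "finite {x. poly (tau B f - tau C f) x = 0}"
    by (intro poly_roots_finite) simp
  moreover obtain M1 where M1: "\<forall>M\<ge>M1. \<forall>m\<ge>2. poly (tau B f) (of_nat m / (of_nat m - 1))
      = spec_eval m M (1 / (of_nat m - 1)) f"
    using poly_tau[OF B(1) f B(2)] by blast
  moreover obtain M2 where M2: "\<forall>M\<ge>M2. \<forall>m\<ge>2. poly (tau C f) (of_nat m / (of_nat m - 1))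
      = spec_eval m M (1 / (of_nat m - 1)) f"
    using poly_tau[OF C(1) f C(2)] by blast
  \<comment> \<open>The larger of the two cutoffs serves both bases.\<close>
  have "poly (tau B f) (of_nat m / (of_nat m - 1)) = poly (tau C f) (of_nat m / (of_nat m - 1))"
    if "m \<ge> 2" for m
    using M1[rule_format, of "max M1 M2" m] M2[rule_format, of "max M1 M2" m] that by simp
  then have "(\<lambda>m. of_nat m / (of_nat m - 1)) ` {2..} \<subseteq> {x. poly (tau B f - tau C f) x = 0}"
    by auto
  moreover have "inj_on (\<lambda>m. of_nat m / (of_nat m - 1) :: rat) {2..}"
  proof (rule inj_onI)
    fix k m :: nat assume "k \<in> {2..}" "m \<in> {2..}"
      and "of_nat k / (of_nat k - 1) = (of_nat m / (of_nat m - 1) :: rat)"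
    then have "of_nat k * (of_nat m - 1) = (of_nat m * (of_nat k - 1) :: rat)"
      by (simp add: frac_eq_eq)
    then have "(of_nat k :: rat) = of_nat m" by (simp add: algebra_simps)
    then show "k = m" by simp
  qed
  ultimately have "finite {2 :: nat..}"
    by (meson finite_imageD finite_subset)
  then show False by (simp add: infinite_Ici)
qed

text \<open>Translates equality of polynomials into equality of the sums over partitions of a fixed
  length.\<close>

lemma coeff_tau:
  assumes "is_basis B" "f \<in> Sym"
  shows "coeff (tau B f) k = (\<Sum>lam\<in>{lam. length lam = k \<and> bcoeff B f lam \<noteq> 0}. bcoeff B f lam)"
proof -
  let ?A = "{lam. bcoeff B f lam \<noteq> 0}"
  have fin: "finite ?A"
    using is_basis_bcoeff(1)[OF assms] by (simp add: coeff_family_def)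
  have "coeff (tau B f) k = (\<Sum>lam\<in>?A. if length lam = k then bcoeff B f lam else 0)"
    by (simp add: tau_def coeff_sum)
  also have "\<dots> = (\<Sum>lam\<in>{lam\<in>?A. length lam = k}. bcoeff B f lam)"
    using fin by (rule sum.inter_filter[symmetric])
  also have "{lam\<in>?A. length lam = k} = {lam. length lam = k \<and> bcoeff B f lam \<noteq> 0}"
    by blast
  finally show ?thesis .
qed

section \<open>Paths and arbitrary tree families as bases\<close>

lemma rooted_tree_path:
  assumes "n \<ge> 1"
  shows "rooted_tree (path_V n) (path_E n)"
proof -
  have "simple_graph (path_V n) (path_E n)"
    by (auto simp: simple_graph_def path_V_def path_E_def)
  \<comment> \<open>The root is 0 and the rank of a vertex is its index; truncation of
    \<open>i - 1\<close> occurs only at the root, which has no parent.\<close>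
  moreover have "rooted_forest (path_V n) (path_E n) (path_V n - {0}) (\<lambda>i. i - 1) (\<lambda>i. i)"
    by (auto simp: rooted_forest_def path_V_def path_E_def)
  moreover have "0 \<in> path_V n" using assms by (simp add: path_V_def)
  ultimately show ?thesis unfolding rooted_tree_def by blast
qed

lemma is_basis_rooted_trees:
  assumes "\<forall>n\<ge>1. rooted_tree (TV n) (TE n) \<and> card (TV n) = n"
  shows "is_basis (\<lambda>lam. chrom (union_V TV lam) (union_E TE lam) (\<lambda>_. 1))"
proof (rule is_basis_psum_expansion)
  fix lam assume lam: "lam \<in> partitions"
  then have "n \<ge> 1" if "n \<in> set lam" for n
    using that by (cases n) (auto simp: partitions_def)
  then have "simple_graph (union_V TV lam) (union_E TE lam)"
    using assms by (intro simple_graph_union) (auto simp: rooted_tree_def)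
  then show "chrom (union_V TV lam) (union_E TE lam) (\<lambda>_. 1) \<in> Sym"
    by (intro chrom_in_Sym) (simp add: weighted_graph_def)
  show "\<exists>c. psum_expansion (chrom (union_V TV lam) (union_E TE lam) (\<lambda>_. 1)) lam c"
    by (rule chrom_union_trees_expansion[OF assms lam])
qed

theorem theorem3p1:
  fixes TV :: "nat \<Rightarrow> 'b set" and TE :: "nat \<Rightarrow> 'b \<Rightarrow> 'b \<Rightarrow> bool"
  assumes "\<forall>n\<ge>1. tree (TV n) (TE n) \<and> card (TV n) = n"
  defines "XT \<equiv> (\<lambda>lam. chrom (union_V TV lam) (union_E TE lam) (\<lambda>_. 1))"
  shows "is_basis XT
    \<and> (\<forall>(V :: 'v set) E \<omega>. weighted_graph V E \<omega> \<longrightarrow>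
         (\<forall>k::nat.
            (\<Sum>lam\<in>{lam. length lam = k \<and> bcoeff XT (chrom V E \<omega>) lam \<noteq> 0}. bcoeff XT (chrom V E \<omega>) lam)
          = (\<Sum>lam\<in>{lam. length lam = k \<and> bcoeff XP (chrom V E \<omega>) lam \<noteq> 0}. bcoeff XP (chrom V E \<omega>) lam))
         \<and> tau XT (chrom V E \<omega>) = tau XP (chrom V E \<omega>))"
proof -
  have T: "\<forall>n\<ge>1. rooted_tree (TV n) (TE n) \<and> card (TV n) = n"
    using assms(1) tree_imp_rooted_tree by blast
  have P: "\<forall>n\<ge>1. rooted_tree (path_V n) (path_E n) \<and> card (path_V n) = n"
    using rooted_tree_path by (simp add: path_V_def)
  have XP: "XP = (\<lambda>lam. chrom (union_V path_V lam) (union_E path_E lam) (\<lambda>_. 1))"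
    by (simp add: XP_def fun_eq_iff)
  have bT: "is_basis XT" unfolding XT_def by (rule is_basis_rooted_trees[OF T])
  have bP: "is_basis XP" unfolding XP by (rule is_basis_rooted_trees[OF P])
  have tau: "tau XT f = tau XP f" if "f \<in> Sym" for f
    using that chrom_union_trees_expansion[OF T] chrom_union_trees_expansion[OF P]
    by (intro tau_unique bT bP) (simp_all add: XT_def XP)
  show ?thesis
  proof (intro conjI allI impI)
    show "is_basis XT" by (rule bT)
    fix V :: "'v set" and E \<omega> assume "weighted_graph V E \<omega>"
    then have f: "chrom V E \<omega> \<in> Sym" by (rule chrom_in_Sym)
    show "tau XT (chrom V E \<omega>) = tau XP (chrom V E \<omega>)" by (rule tau[OF f])
    \<comment> \<open>Both sides are coefficients of x^k, in two equal polynomials.\<close>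
    then show "(\<Sum>lam\<in>{lam. length lam = k \<and> bcoeff XT (chrom V E \<omega>) lam \<noteq> 0}. bcoeff XT (chrom V E \<omega>) lam)
        = (\<Sum>lam\<in>{lam. length lam = k \<and> bcoeff XP (chrom V E \<omega>) lam \<noteq> 0}. bcoeff XP (chrom V E \<omega>) lam)" for k
      using coeff_tau[OF bT f, of k] coeff_tau[OF bP f, of k] by simp
  qed
qed

end
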